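(* Let $q\ge 2$ be an integer, let $a\in\mathbb{S}(\mathbb{C}^q)$ and let $f$ denote a formal Fourier series on $\mathbb{T}$. The kernel $\Gamma_a[f]$ defines a bounded operator on $\ell^2(\mathbb{F}_q^+)$ if and only if $f\in L^\infty(\mathbb{T})$. Moreover, there exists a unitary operator $U_a:\ell^2(\mathbb{F}_q^+)\to\bigoplus_{k=1}^\infty\ell^2(\mathbb{N})$ such that for all $f\in L^\infty(\mathbb{T})$, $$\Gamma_a[f]=U_a^{-1}\Big(\bigoplus_{k=1}^\infty\Gamma_1[f]\Big)U_a.$$ In particular, for any $a\in\mathbb{S}(\mathbb{C}^q)$, the operators $\Gamma_q[f]$ (on $\ell^2(T_q)$) and $\Gamma_a[f]$ are simultaneously unitarily equivalent for all $f\in L^\infty(\mathbb{T})$ (i.e. via one unitary independent of $f$).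
   Context: $\mathbb{T}=\mathbb{R}/2\pi\mathbb{Z}$, $\mathbb{N}=\{0,1,2,\dots\}$. A formal Fourier series $f\sim\sum_{n\in\mathbb{Z}}\widehat f(n)e^{in\theta}$ is an arbitrary sequence $(\widehat f(n))_{n\in\mathbb{Z}}$ of complex numbers; a function $f\in L^1(\mathbb{T})$ is identified with the series with coefficients $\widehat f(n)=\int_{\mathbb{T}} f(e^{i\theta})e^{-in\theta}\frac{d\theta}{2\pi}$, and "$f\in L^\infty(\mathbb{T})$" means that $f$ is the Fourier series of such a function. $\mathbb{F}_q^+$ is the free unital semigroup on generators $s_1,\dots,s_q$ with neutral element $e$ (empty word); $|u|$ is the length of a word $u$. $\mathbb{S}(\mathbb{C}^q)=\{a=(a_1,\dots,a_q)\in\mathbb{C}^q:\sum_{k}|a_k|^2=1\}$. For $a\in\mathbb{S}(\mathbb{C}^q)$ and $w=s_{i_1}\cdots s_{i_n}$, set $[w](a)=a_{i_1}\cdots a_{i_n}$, and $[e](a)=1$. Define $\Gamma_a[f]:\mathbb{F}_q^+\times\mathbb{F}_q^+\to\mathbb{C}$ by $$\Gamma_a[f](u,v)=\begin{cases}\widehat f(|u|-|v|)\,[w](a), & u=wv \text{ for some } w\in\mathbb{F}_q^+,\\ \widehat f(|u|-|v|)\,\overline{[w](a)}, & v=wu\text{ for some } w\in\mathbb{F}_q^+,\\ 0,&\text{otherwise.}\end{cases}$$ $T_q$ is the infinite rooted tree in which every vertex has exactly $q$ children, with graph distance $d$, root $o$, $|\sigma|=d(o,\sigma)$; two vertices are comparable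 if they lie on a common geodesic ray from the root. $\Gamma_q[f](\sigma_1,\sigma_2)=q^{-d(\sigma_1,\sigma_2)/2}\widehat f(|\sigma_1|-|\sigma_2|)$ if $\sigma_1,\sigma_2$ are comparable and $0$ otherwise. $\Gamma_1[f]$ is the Toeplitz operator on $\ell^2(\mathbb{N})$ with matrix $[\widehat f(k-l)]_{k,l\in\mathbb{N}}$, bounded when $f\in L^\infty(\mathbb{T})$; for $f\in L^\infty(\mathbb{T})$ the kernel $\Gamma_q[f]$ represents a bounded operator on $\ell^2(T_q)$. A bounded operator $A$ on $\ell^2(X)$ is identified with its kernel $A(x,y)=\langle A\delta_y,\delta_x\rangle$; a kernel defines a bounded operator if it is the kernel of some element of $B(\ell^2(X))$. *)

theory Defs
  imports "HOL-Analysis.Analysis"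
begin

section \<open>Complex inner product spaces and Hilbert direct sums\<close>

text \<open>The inner product is linear in the first argument.\<close>

class cinner_space = real_normed_vector +
  fixes scaleC :: "complex \<Rightarrow> 'a \<Rightarrow> 'a" (infixr "*\<^sub>C" 75)
    and cinner :: "'a \<Rightarrow> 'a \<Rightarrow> complex"
  assumes scaleC_add_right: "c *\<^sub>C (x + y) = c *\<^sub>C x + c *\<^sub>C y"
    and scaleC_add_left: "(c + d) *\<^sub>C x = c *\<^sub>C x + d *\<^sub>C x"
    and scaleC_scaleC: "c *\<^sub>C d *\<^sub>C x = (c * d) *\<^sub>C x"
    and scaleR_scaleC: "r *\<^sub>R x = complex_of_real r *\<^sub>C x"
    and cinner_commute: "cinner x y = cnj (cinner y x)"
    and cinner_add_left: "cinner (x + y) z = cinner x z + cinner y z"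
    and cinner_scaleC_left: "cinner (c *\<^sub>C x) y = c * cinner x y"
    and cinner_self: "cinner x x = complex_of_real ((norm x)\<^sup>2)"
begin

lemma norm_scaleC: "norm (c *\<^sub>C x) = cmod c * norm x"
proof -
  have "cinner (c *\<^sub>C x) (c *\<^sub>C x) = c * cnj (cinner (c *\<^sub>C x) x)"
    using cinner_commute[of x "c *\<^sub>C x"] by (simp add: cinner_scaleC_left)
  also have "\<dots> = (c * cnj c) * complex_of_real ((norm x)\<^sup>2)"
    by (simp add: cinner_scaleC_left cinner_self)
  also have "\<dots> = complex_of_real ((cmod c * norm x)\<^sup>2)"
    by (simp only: complex_norm_square[symmetric] power_mult_distrib of_real_mult of_real_power)
  finally have "(norm (c *\<^sub>C x))\<^sup>2 = (cmod c * norm x)\<^sup>2"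
    unfolding cinner_self of_real_eq_iff .
  then show ?thesis
    by (rule power2_eq_imp_eq) simp_all
qed

lemma cmod_cinner_le: "cmod (cinner x y) \<le> (norm x)\<^sup>2 + (norm y)\<^sup>2"
proof -
  define z where "z = cinner x y"
  define c where "c = - cnj (sgn z)"
  have c: "cmod c \<le> 1" by (simp add: c_def norm_sgn)
  have cz: "c * z = - complex_of_real (cmod z)"
  proof (cases "z = 0")
    case False
    have "cnj z * z = (complex_of_real (cmod z))\<^sup>2"
      by (simp only: of_real_power[symmetric] complex_norm_square mult.commute)
    moreover have "c * z = - (cnj z * z / complex_of_real (cmod z))"
      by (simp add: c_def sgn_eq)
    ultimately show ?thesis
      using False by (simp add: power2_eq_square)
  qed (simp add: c_def)
  have yx: "cinner y (c *\<^sub>C x) = cnj (c * z)"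
    using cinner_commute[of y "c *\<^sub>C x"] by (simp add: cinner_scaleC_left z_def)
  have add_right: "cinner u (v + w) = cinner u v + cinner u w" for u v w
  proof -
    have "cinner u (v + w) = cnj (cinner v u + cinner w u)"
      by (subst cinner_commute) (simp only: cinner_add_left)
    also have "\<dots> = cinner u v + cinner u w"
      by (simp only: complex_cnj_add cinner_commute[of u v] cinner_commute[of u w])
    finally show ?thesis .
  qed
  have "cinner (c *\<^sub>C x + y) (c *\<^sub>C x + y) =
        cinner (c *\<^sub>C x) (c *\<^sub>C x) + c * z + cnj (c * z) + cinner y y"
    by (simp only: cinner_add_left add_right yx cinner_scaleC_left[of c x y] z_def Groups.add_ac)
  then have "complex_of_real ((norm (c *\<^sub>C x + y))\<^sup>2) =
      complex_of_real ((norm (c *\<^sub>C x))\<^sup>2 - 2 * cmod z + (norm y)\<^sup>2)"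
    by (simp add: cinner_self cz)
  then have "(norm (c *\<^sub>C x + y))\<^sup>2 = (norm (c *\<^sub>C x))\<^sup>2 - 2 * cmod z + (norm y)\<^sup>2"
    by (simp only: of_real_eq_iff)
  then have "2 * cmod z \<le> (norm (c *\<^sub>C x))\<^sup>2 + (norm y)\<^sup>2"
    by (smt (verit) zero_le_power2)
  moreover have "norm (c *\<^sub>C x) \<le> norm x"
    using c by (simp add: norm_scaleC mult_left_le_one_le)
  then have "(norm (c *\<^sub>C x))\<^sup>2 \<le> (norm x)\<^sup>2"
    by (simp add: power_mono)
  moreover have "0 \<le> cmod z" by simp
  ultimately show ?thesis
    unfolding z_def by linarith
qed

end

instantiation complex :: cinner_space
begin

definition scaleC_complex :: "complex \<Rightarrow> complex \<Rightarrow> complex"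
  where "scaleC_complex c z = c * z"

definition cinner_complex :: "complex \<Rightarrow> complex \<Rightarrow> complex"
  where "cinner_complex z w = z * cnj w"

instance
proof
  fix c d z w v :: complex and r :: real
  show "c *\<^sub>C (z + w) = c *\<^sub>C z + c *\<^sub>C w" "(c + d) *\<^sub>C z = c *\<^sub>C z + d *\<^sub>C z"
    "c *\<^sub>C d *\<^sub>C z = (c * d) *\<^sub>C z" "r *\<^sub>R z = complex_of_real r *\<^sub>C z"
    by (simp_all add: scaleC_complex_def algebra_simps scaleR_conv_of_real)
  show "cinner z w = cnj (cinner w z)" "cinner (z + w) v = cinner z v + cinner w v"
    "cinner (c *\<^sub>C z) w = c * cinner z w"
    by (simp_all add: cinner_complex_def scaleC_complex_def algebra_simps)
  show "cinner z z = complex_of_real ((cmod z)\<^sup>2)"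
    unfolding cinner_complex_def by (simp only: complex_norm_square)
qed

end

text \<open>The Hilbert direct sum of copies of \<open>'h\<close> indexed by the type \<open>'i\<close>.\<close>

typedef (overloaded) ('i, 'h) l2sum =
    "{x :: 'i \<Rightarrow> 'h::cinner_space. (\<lambda>i. (norm (x i))\<^sup>2) summable_on UNIV}"
  morphisms coord Abs_l2sum
  by (intro exI[of _ "\<lambda>_. 0"]) simp

type_synonym 'x ell2 = "('x, complex) l2sum"

lemma l2_summable: "(\<lambda>i. (norm (coord x i))\<^sup>2) summable_on UNIV"
  using coord[of x] by simp

lemma l2sum_eqI: "(\<And>i. coord x i = coord y i) \<Longrightarrow> x = y"
  by (simp add: coord_inject[symmetric] fun_eq_iff)

lemma norm_add_sq_le:
  fixes a b :: "'a::real_normed_vector"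
  shows "(norm (a + b))\<^sup>2 \<le> 2 * (norm a)\<^sup>2 + 2 * (norm b)\<^sup>2"
proof -
  have "(norm (a + b))\<^sup>2 \<le> (norm a + norm b)\<^sup>2"
    by (simp add: norm_triangle_ineq power_mono)
  also have "\<dots> \<le> 2 * (norm a)\<^sup>2 + 2 * (norm b)\<^sup>2"
    using sum_squares_bound[of "norm a" "norm b"] by (simp add: power2_sum)
  finally show ?thesis .
qed

lemma l2_summable_add: "(\<lambda>i. (norm (coord x i + coord y i))\<^sup>2) summable_on UNIV"
  by (rule summable_on_comparison_test
      [of "\<lambda>i. 2 * (norm (coord x i))\<^sup>2 + 2 * (norm (coord y i))\<^sup>2"])
    (auto intro!: summable_on_add summable_on_cmult_right l2_summable norm_add_sq_le)

lemma l2_summable_scaleC: "(\<lambda>i. (norm (c *\<^sub>C coord x i))\<^sup>2) summable_on UNIV"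
  by (auto simp: norm_scaleC power_mult_distrib intro!: summable_on_cmult_right l2_summable)

lemma l2_cinner_summable: "(\<lambda>i. cinner (coord x i) (coord y i)) summable_on UNIV"
proof (rule Infinite_Sum.abs_summable_summable,
    rule Infinite_Sum.abs_summable_on_comparison_test')
  show "(\<lambda>i. (norm (coord x i))\<^sup>2 + (norm (coord y i))\<^sup>2) summable_on UNIV"
    by (intro summable_on_add l2_summable)
qed (rule cmod_cinner_le)

instantiation l2sum :: (type, cinner_space) cinner_space
begin

definition zero_l2sum :: "('a, 'b) l2sum" where "0 = Abs_l2sum (\<lambda>_. 0)"

definition plus_l2sum :: "('a, 'b) l2sum \<Rightarrow> ('a, 'b) l2sum \<Rightarrow> ('a, 'b) l2sum"
  where "x + y = Abs_l2sum (\<lambda>i. coord x i + coord y i)"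

definition scaleC_l2sum :: "complex \<Rightarrow> ('a, 'b) l2sum \<Rightarrow> ('a, 'b) l2sum"
  where "c *\<^sub>C x = Abs_l2sum (\<lambda>i. c *\<^sub>C coord x i)"

definition scaleR_l2sum :: "real \<Rightarrow> ('a, 'b) l2sum \<Rightarrow> ('a, 'b) l2sum"
  where "r *\<^sub>R x = complex_of_real r *\<^sub>C (x :: ('a, 'b) l2sum)"

definition uminus_l2sum :: "('a, 'b) l2sum \<Rightarrow> ('a, 'b) l2sum"
  where "- x = (- 1) *\<^sub>C (x :: ('a, 'b) l2sum)"

definition minus_l2sum :: "('a, 'b) l2sum \<Rightarrow> ('a, 'b) l2sum \<Rightarrow> ('a, 'b) l2sum"
  where "x - y = x + - (y :: ('a, 'b) l2sum)"

definition cinner_l2sum :: "('a, 'b) l2sum \<Rightarrow> ('a, 'b) l2sum \<Rightarrow> complex"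
  where "cinner x y = (\<Sum>\<^sub>\<infinity>i. cinner (coord x i) (coord y i))"

definition norm_l2sum :: "('a, 'b) l2sum \<Rightarrow> real"
  where "norm x = sqrt (\<Sum>\<^sub>\<infinity>i. (norm (coord x i))\<^sup>2)"

definition sgn_l2sum :: "('a, 'b) l2sum \<Rightarrow> ('a, 'b) l2sum"
  where "sgn x = inverse (norm x) *\<^sub>R (x :: ('a, 'b) l2sum)"

definition dist_l2sum :: "('a, 'b) l2sum \<Rightarrow> ('a, 'b) l2sum \<Rightarrow> real"
  where "dist x y = norm (x - y :: ('a, 'b) l2sum)"

definition uniformity_l2sum :: "(('a, 'b) l2sum \<times> ('a, 'b) l2sum) filter"
  where "uniformity_l2sum = (INF e\<in>{0<..}. principal {(x, y). dist x y < e})"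

definition open_l2sum :: "('a, 'b) l2sum set \<Rightarrow> bool"
  where "open_l2sum S = (\<forall>x\<in>S. \<forall>\<^sub>F (x', y) in uniformity. x' = x \<longrightarrow> y \<in> S)"

lemma coord_zero [simp]: "coord (0 :: ('a, 'b) l2sum) i = 0"
  by (simp add: zero_l2sum_def Abs_l2sum_inverse)

lemma coord_add [simp]: "coord (x + y :: ('a, 'b) l2sum) i = coord x i + coord y i"
  by (simp add: plus_l2sum_def Abs_l2sum_inverse l2_summable_add)

lemma coord_scaleC [simp]: "coord (c *\<^sub>C x :: ('a, 'b) l2sum) i = c *\<^sub>C coord x i"
  by (simp add: scaleC_l2sum_def Abs_l2sum_inverse l2_summable_scaleC)

lemma coord_scaleR [simp]: "coord (r *\<^sub>R x :: ('a, 'b) l2sum) i = r *\<^sub>R coord x i"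
  by (simp add: scaleR_l2sum_def scaleR_scaleC)

lemma coord_uminus [simp]: "coord (- x :: ('a, 'b) l2sum) i = - coord x i"
proof -
  have "(- 1) *\<^sub>C coord x i = (- 1 :: real) *\<^sub>R coord x i"
    by (simp only: scaleR_scaleC of_real_minus of_real_1)
  then show ?thesis by (simp add: uminus_l2sum_def)
qed

lemma coord_minus [simp]: "coord (x - y :: ('a, 'b) l2sum) i = coord x i - coord y i"
  by (simp add: minus_l2sum_def)

lemma norm_sq_l2sum: "(norm (x :: ('a, 'b) l2sum))\<^sup>2 = (\<Sum>\<^sub>\<infinity>i. (norm (coord x i))\<^sup>2)"
  by (simp add: norm_l2sum_def infsum_nonneg)

lemma L2_set_le_norm:
  assumes "finite F"
  shows "L2_set (\<lambda>i. norm (coord x i)) F \<le> norm (x :: ('a, 'b) l2sum)"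
  unfolding L2_set_def norm_l2sum_def real_sqrt_le_iff
  using assms by (intro finite_sum_le_infsum l2_summable) auto

lemma norm_l2sum_triangle: "norm (x + y) \<le> norm x + norm (y :: ('a, 'b) l2sum)"
proof -
  have nn: "0 \<le> norm (z :: ('a, 'b) l2sum)" for z
    by (simp add: norm_l2sum_def infsum_nonneg)
  have "(\<Sum>\<^sub>\<infinity>i. (norm (coord (x + y) i))\<^sup>2) \<le> (norm x + norm y)\<^sup>2"
  proof (rule infsum_le_finite_sums[OF l2_summable])
    fix F :: "'a set" assume F: "finite F"
    have "L2_set (\<lambda>i. norm (coord (x + y) i)) F
        \<le> L2_set (\<lambda>i. norm (coord x i) + norm (coord y i)) F"
      by (intro L2_set_mono) (auto simp: norm_triangle_ineq)
    also have "\<dots> \<le> L2_set (\<lambda>i. norm (coord x i)) F + L2_set (\<lambda>i. norm (coord y i)) F"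
      by (rule L2_set_triangle_ineq)
    also have "\<dots> \<le> norm x + norm y"
      by (intro add_mono L2_set_le_norm F)
    finally have "sqrt (\<Sum>i\<in>F. (norm (coord (x + y) i))\<^sup>2) \<le> norm x + norm y"
      by (simp add: L2_set_def)
    then show "(\<Sum>i\<in>F. (norm (coord (x + y) i))\<^sup>2) \<le> (norm x + norm y)\<^sup>2"
      using nn by (simp add: real_sqrt_le_iff' sqrt_le_D)
  qed
  then show ?thesis
    unfolding norm_l2sum_def[of "x + y"] using nn
    by (intro real_le_lsqrt) auto
qed

instance
proof
  fix x y z :: "('a, 'b) l2sum" and c d :: complex and r s :: real
  show "x + y + z = x + (y + z)" "x + y = y + x" "0 + x = x" "- x + x = 0" "x - y = x + - y"
    by (rule l2sum_eqI, simp add: algebra_simps)+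
  show "r *\<^sub>R (x + y) = r *\<^sub>R x + r *\<^sub>R y" "(r + s) *\<^sub>R x = r *\<^sub>R x + s *\<^sub>R x"
    "r *\<^sub>R s *\<^sub>R x = (r * s) *\<^sub>R x" "1 *\<^sub>R x = x"
    by (rule l2sum_eqI, simp add: scaleR_add_right scaleR_add_left)+
  show "c *\<^sub>C (x + y) = c *\<^sub>C x + c *\<^sub>C y" "(c + d) *\<^sub>C x = c *\<^sub>C x + d *\<^sub>C x"
    "c *\<^sub>C d *\<^sub>C x = (c * d) *\<^sub>C x"
    by (rule l2sum_eqI, simp add: scaleC_add_right scaleC_add_left scaleC_scaleC)+
  show "r *\<^sub>R x = complex_of_real r *\<^sub>C x" by (rule scaleR_l2sum_def)
  show "norm x = 0 \<longleftrightarrow> x = 0"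
  proof
    assume "norm x = 0"
    then have "(\<Sum>\<^sub>\<infinity>i. (norm (coord x i))\<^sup>2) \<le> 0" by (simp add: norm_l2sum_def)
    then have "(norm (coord x i))\<^sup>2 = 0" for i
      by (rule nonneg_infsum_le_0D[OF _ l2_summable]) auto
    then show "x = 0" by (intro l2sum_eqI) simp
  qed (simp add: norm_l2sum_def)
  show "norm (x + y) \<le> norm x + norm y" by (rule norm_l2sum_triangle)
  show "norm (r *\<^sub>R x) = \<bar>r\<bar> * norm x"
    by (simp add: norm_l2sum_def power_mult_distrib infsum_cmult_right' real_sqrt_mult)
  show "sgn x = inverse (norm x) *\<^sub>R x" by (rule sgn_l2sum_def)
  show "dist x y = norm (x - y)" by (rule dist_l2sum_def)
  show "uniformity = (INF e\<in>{0<..}. principal {(x :: ('a, 'b) l2sum, y). dist x y < e})"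
    by (rule uniformity_l2sum_def)
  show "open S = (\<forall>x\<in>S. \<forall>\<^sub>F (x', y) in uniformity. x' = x \<longrightarrow> y \<in> S)"
    for S :: "('a, 'b) l2sum set" by (rule open_l2sum_def)
  show "cinner x y = cnj (cinner y x)"
    by (simp add: cinner_l2sum_def infsum_cnj[symmetric] cinner_commute[symmetric] del: infsum_cnj)
  show "cinner (x + y) z = cinner x z + cinner y z"
    by (simp add: cinner_l2sum_def cinner_add_left infsum_add l2_cinner_summable)
  show "cinner (c *\<^sub>C x) y = c * cinner x y"
    by (simp add: cinner_l2sum_def cinner_scaleC_left infsum_cmult_right')
  have "((\<lambda>i. complex_of_real ((norm (coord x i))\<^sup>2)) has_sum
      complex_of_real (\<Sum>\<^sub>\<infinity>i. (norm (coord x i))\<^sup>2)) UNIV"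
    by (simp only: has_sum_of_real_iff has_sum_infsum l2_summable)
  then have "(\<Sum>\<^sub>\<infinity>i. complex_of_real ((norm (coord x i))\<^sup>2)) =
      complex_of_real (\<Sum>\<^sub>\<infinity>i. (norm (coord x i))\<^sup>2)"
    by (rule infsumI)
  then show "cinner x x = complex_of_real ((norm x)\<^sup>2)"
    by (simp only: cinner_l2sum_def cinner_self norm_sq_l2sum)
qed

end

definition bounded_clinear :: "('a::cinner_space \<Rightarrow> 'b::cinner_space) \<Rightarrow> bool"
  where "bounded_clinear A \<longleftrightarrow> bounded_linear A \<and> (\<forall>c x. A (c *\<^sub>C x) = c *\<^sub>C A x)"

definition unitary :: "('a::cinner_space \<Rightarrow> 'b::cinner_space) \<Rightarrow> bool"
  where "unitary U \<longleftrightarrow>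
    bounded_clinear U \<and> surj U \<and> (\<forall>x y. cinner (U x) (U y) = cinner x y)"

definition direct_sum_op ::
    "('i \<Rightarrow> 'h::cinner_space \<Rightarrow> 'h) \<Rightarrow> ('i, 'h) l2sum \<Rightarrow> ('i, 'h) l2sum"
  where "direct_sum_op A x = Abs_l2sum (\<lambda>i. A i (coord x i))"


section \<open>Kernels\<close>

definition delta :: "'x \<Rightarrow> 'x ell2"
  where "delta x = Abs_l2sum (\<lambda>y. if y = x then 1 else 0)"

definition kernel_of :: "('x ell2 \<Rightarrow> 'x ell2) \<Rightarrow> 'x \<Rightarrow> 'x \<Rightarrow> complex"
  where "kernel_of A x y = cinner (A (delta y)) (delta x)"

definition defines_bounded_operator :: "('x \<Rightarrow> 'x \<Rightarrow> complex) \<Rightarrow> bool"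
  where "defines_bounded_operator K \<longleftrightarrow> (\<exists>A. bounded_clinear A \<and> kernel_of A = K)"

text \<open>Meaningful only for kernels with \<^const>\<open>defines_bounded_operator\<close>; for these the
  operator is unique, see \<open>kernel_of_inject\<close>.\<close>

definition operator_of :: "('x \<Rightarrow> 'x \<Rightarrow> complex) \<Rightarrow> 'x ell2 \<Rightarrow> 'x ell2"
  where "operator_of K = (THE A. bounded_clinear A \<and> kernel_of A = K)"

lemma coord_delta: "coord (delta x) y = (if y = x then 1 else 0)"
proof -
  have "(\<lambda>y. (cmod (if y = x then 1 else 0))\<^sup>2) summable_on UNIV"
    by (rule finite_nonzero_values_imp_summable_on) (auto intro: finite_subset[of _ "{x}"])
  then show ?thesis
    unfolding delta_def by (subst Abs_l2sum_inverse) auto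
qed

lemma cinner_delta: "cinner \<phi> (delta x) = coord \<phi> x"
proof -
  have "cinner \<phi> (delta x) = (\<Sum>\<^sub>\<infinity>y\<in>{x}. coord \<phi> y)"
    unfolding cinner_l2sum_def
    by (rule infsum_cong_neutral) (auto simp: coord_delta cinner_complex_def)
  then show ?thesis by simp
qed

lemma coord_sum: "coord (\<Sum>j\<in>F. g j) i = (\<Sum>j\<in>F. coord (g j) i)"
  by (induction F rule: infinite_finite_induct) auto

lemma delta_expansion:
  "((\<lambda>x. coord \<phi> x *\<^sub>C delta x) has_sum \<phi>) UNIV"
proof -
  let ?s = "\<lambda>F. \<Sum>x\<in>F. coord \<phi> x *\<^sub>C delta x"
  let ?n = "\<lambda>x. (norm (coord \<phi> x))\<^sup>2"
  have c: "coord (?s F) y = (if y \<in> F then coord \<phi> y else 0)" if "finite F" for F y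
    using that by (simp add: coord_sum coord_delta scaleC_complex_def if_distrib cong: if_cong)
  have d: "dist (?s F) \<phi> = sqrt (infsum ?n UNIV - sum ?n F)" if F: "finite F" for F
  proof -
    have "(\<Sum>\<^sub>\<infinity>y. (norm (coord (?s F - \<phi>) y))\<^sup>2) = (\<Sum>\<^sub>\<infinity>y\<in>UNIV - F. ?n y)"
      by (rule infsum_cong_neutral) (auto simp: c[OF F])
    also have "\<dots> = infsum ?n UNIV - infsum ?n F"
      by (rule infsum_Diff[OF l2_summable]) (use F in auto)
    finally show ?thesis
      using F by (simp add: dist_norm norm_l2sum_def)
  qed
  have "((\<lambda>F. sum ?n F) \<longlongrightarrow> infsum ?n UNIV) (finite_subsets_at_top UNIV)"
    using has_sum_infsum[OF l2_summable[of \<phi>]] by (simp add: has_sum_def)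
  then have "((\<lambda>F. sqrt (infsum ?n UNIV - sum ?n F)) \<longlongrightarrow> sqrt (infsum ?n UNIV - infsum ?n UNIV))
      (finite_subsets_at_top UNIV)"
    by (intro tendsto_intros)
  moreover have "\<forall>\<^sub>F F in finite_subsets_at_top UNIV.
      sqrt (infsum ?n UNIV - sum ?n F) = dist (?s F) \<phi>"
    by (rule eventually_finite_subsets_at_top_weakI) (simp only: d)
  ultimately have "((\<lambda>F. dist (?s F) \<phi>) \<longlongrightarrow> sqrt (infsum ?n UNIV - infsum ?n UNIV))
      (finite_subsets_at_top UNIV)"
    by (rule Lim_transform_eventually)
  then have "((\<lambda>F. dist (?s F) \<phi>) \<longlongrightarrow> 0) (finite_subsets_at_top UNIV)"
    by (simp only: diff_self real_sqrt_zero)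
  then show ?thesis
    unfolding has_sum_def by (subst tendsto_dist_iff)
qed

lemma kernel_of_inject:
  fixes A B :: "'x ell2 \<Rightarrow> 'x ell2"
  assumes A: "bounded_clinear A" and B: "bounded_clinear B" and K: "kernel_of A = kernel_of B"
  shows "A = B"
proof
  fix \<phi> :: "'x ell2"
  have AB: "A (delta y) = B (delta y)" for y
    using K by (intro l2sum_eqI) (simp add: kernel_of_def cinner_delta fun_eq_iff)
  have hs: "((\<lambda>y. coord \<phi> y *\<^sub>C T (delta y)) has_sum T \<phi>) UNIV" if "bounded_clinear T" for T :: "'x ell2 \<Rightarrow> 'x ell2"
    using has_sum_bounded_linear[OF _ delta_expansion[of \<phi>], of T] that
    by (simp add: bounded_clinear_def o_def)
  show "A \<phi> = B \<phi>"
    using hs[OF A] hs[OF B] by (simp add: AB has_sum_unique)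
qed

lemma operator_of_eq:
  assumes "bounded_clinear A" "kernel_of A = K"
  shows "operator_of K = A"
  unfolding operator_of_def using assms by (auto intro: kernel_of_inject)


section \<open>Formal Fourier series\<close>

type_synonym fourier_series = "int \<Rightarrow> complex"

text \<open>Functions on the circle are \<open>2\<pi>\<close>-periodic functions of \<open>\<theta>\<close>.\<close>

definition fourier_coeff :: "(real \<Rightarrow> complex) \<Rightarrow> fourier_series"
  where "fourier_coeff g n =
    (LINT \<theta>:{0..2*pi}|lebesgue. g \<theta> * cis (- (of_int n * \<theta>))) / complex_of_real (2 * pi)"

definition Linf_circle :: "(real \<Rightarrow> complex) set"
  where "Linf_circle = {g. g \<in> borel_measurable lebesgue \<and> (\<forall>\<theta>. g (\<theta> + 2 * pi) = g \<theta>) \<and>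
    (\<exists>C. AE \<theta> in lebesgue. cmod (g \<theta>) \<le> C)}"

definition Linf_series :: "fourier_series set"
  where "Linf_series = fourier_coeff ` Linf_circle"


section \<open>The kernels\<close>

text \<open>The free unital semigroup on the generators indexed by \<open>'q\<close>, a finite type with
  \<open>q\<close> elements, is \<open>'q list\<close> with concatenation.\<close>

definition unit_sphere :: "(complex ^ 'q) set"
  where "unit_sphere = {a. (\<Sum>k\<in>UNIV. (cmod (a $ k))\<^sup>2) = 1}"

definition word_eval :: "'q list \<Rightarrow> complex ^ 'q \<Rightarrow> complex"
  where "word_eval w a = prod_list (map (\<lambda>i. a $ i) w)"

definition Gamma_word :: "complex ^ 'q \<Rightarrow> fourier_series \<Rightarrow> 'q list \<Rightarrow> 'q list \<Rightarrow> complex"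
  where "Gamma_word a f u v =
    (if \<exists>w. u = w @ v then
       f (int (length u) - int (length v)) * word_eval (THE w. u = w @ v) a
     else if \<exists>w. v = w @ u then
       f (int (length u) - int (length v)) * cnj (word_eval (THE w. v = w @ u) a)
     else 0)"

text \<open>The rooted \<open>q\<close>-ary tree: a vertex is the list of child labels on the way from the vertex
  up to the root, so the children of \<open>v\<close> are the \<open>s # v\<close>.\<close>

type_synonym 'q tree_vertex = "'q list"

definition tree_edges :: "('q tree_vertex \<times> 'q tree_vertex) set"
  where "tree_edges = {(v, s # v) | v s. True} \<union> {(s # v, v) | v s. True}"

definition tree_dist :: "'q tree_vertex \<Rightarrow> 'q tree_vertex \<Rightarrow> nat"
  where "tree_dist x y = (LEAST n. (x, y) \<in> tree_edges ^^ n)"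

definition tree_root :: "'q tree_vertex"
  where "tree_root = []"

definition tree_height :: "'q tree_vertex \<Rightarrow> nat"
  where "tree_height x = tree_dist tree_root x"

definition geodesic_ray :: "(nat \<Rightarrow> 'q tree_vertex) \<Rightarrow> bool"
  where "geodesic_ray \<gamma> \<longleftrightarrow> \<gamma> 0 = tree_root \<and>
    (\<forall>i j. int (tree_dist (\<gamma> i) (\<gamma> j)) = \<bar>int i - int j\<bar>)"

definition comparable :: "'q tree_vertex \<Rightarrow> 'q tree_vertex \<Rightarrow> bool"
  where "comparable x y \<longleftrightarrow> (\<exists>\<gamma>. geodesic_ray \<gamma> \<and> x \<in> range \<gamma> \<and> y \<in> range \<gamma>)"

definition Gamma_tree ::
    "fourier_series \<Rightarrow> 'q::finite tree_vertex \<Rightarrow> 'q tree_vertex \<Rightarrow> complex"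
  where "Gamma_tree f x y =
    (if comparable x y then
       complex_of_real (real CARD('q) powr (- real (tree_dist x y) / 2)) *
         f (int (tree_height x) - int (tree_height y))
     else 0)"

definition Gamma_nat :: "fourier_series \<Rightarrow> nat \<Rightarrow> nat \<Rightarrow> complex"
  where "Gamma_nat f k l = f (int k - int l)"

end

theory Submission
  imports Defs
begin

text \<open>Let \<open>S\<^sub>a\<close> be the operator on \<open>\<ell>\<^sup>2\<close> of the words that sends \<open>\<delta>\<^sub>v\<close> to the sum of the
  \<open>a\<^sub>i \<delta>\<close> at the words \<open>i # v\<close>.  Since \<open>a\<close> is a unit vector, \<open>S\<^sub>a\<close> is an isometry, and formally
  \<open>\<Gamma>\<^sub>a[f]\<close> is the sum of the \<open>f(n) S\<^sub>a\<^sup>n\<close> for \<open>n \<ge> 0\<close> and the \<open>f(-n) S\<^sub>a\<^sup>*\<^sup>n\<close> for \<open>n > 0\<close>, exactly as a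
  Toeplitz matrix is built from the unilateral shift.  So the theorem follows from two facts:
  \<open>S\<^sub>a\<close> is unitarily equivalent to a shift of infinite multiplicity, and a Toeplitz matrix is
  bounded exactly when its symbol is.  The first is the Wold decomposition of \<open>S\<^sub>a\<close>, which can be
  made explicit here.

  If \<open>M\<close> is a unitary matrix with \<open>M b = a\<close>, its tensor powers act on the words of each length
  and form a unitary operator \<open>word_op M\<close> that carries \<open>\<Gamma>\<^sub>b[f]\<close> to \<open>\<Gamma>\<^sub>a[f]\<close>
  (\<open>Gamma_word_matrix_vector\<close>, \<open>kernel_of_word_op_conj\<close>).  A reflection provides such an \<open>M\<close> with
  \<open>b\<close> the basis vector \<open>e\<^sub>k\<close> (\<open>exists_unitary_matrix_to\<close>).  For \<open>e\<^sub>k\<close> the isometry just puts the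
  letter \<open>k\<close> in front of a word.  Every word is uniquely \<open>k\<^sup>n w\<close> with \<open>w\<close> not beginning with \<open>k\<close>;
  for each of the infinitely many \<open>w\<close> the words \<open>k\<^sup>n w\<close> span a copy of \<open>\<ell>\<^sup>2(\<nat>)\<close>, on which
  \<open>\<Gamma>[f]\<close> is the Toeplitz matrix of \<open>f\<close>, and different \<open>w\<close> do not interact (\<open>Gamma_word_axis\<close>).
  Regrouping the coordinates accordingly gives the unitary of the theorem, independent of \<open>f\<close>.

  What remains is the second fact: the matrix \<open>[f(k - l)]\<close> is bounded if and only if \<open>f\<close>
  is the Fourier series of a bounded function \<open>g\<close>.  Boundedness is tested on finite sums
  (\<open>form_bounded\<close>).  Given \<open>g\<close>, the form at \<open>c, d\<close> is the mean of \<open>g\<close> times two trigonometric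
  polynomials, so Parseval's identity for trigonometric polynomials bounds it.  Conversely, testing
  the form on exponentials bounds the Fejer means of \<open>f\<close> uniformly, while the rows of the matrix
  show that \<open>f\<close> is square summable; hence a subsequence of the Fejer means converges fast in
  \<open>L\<^sup>1\<close>, thus almost everywhere, and its bounded limit has the Fourier coefficients \<open>f\<close>.

  On the tree, comparable vertices are words one of which is a suffix of the other, so
  \<open>\<Gamma>\<^sub>q[f]\<close> is the word kernel of the unit vector with all entries \<open>1 / sqrt q\<close>
  (\<open>Gamma_tree_eq_Gamma_word\<close>), and both kernels have the same model.\<close>

section \<open>Unitary operators\<close>

lemma cinner_add_right: "cinner x (y + z) = cinner x y + cinner x (z :: 'a::cinner_space)"
  using cinner_add_left[of y z x]
  by (simp add: cinner_commute[of x "y + z"] cinner_commute[of x y] cinner_commute[of x z])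

lemma cinner_scaleC_right: "cinner x (c *\<^sub>C y) = cnj c * cinner x (y :: 'a::cinner_space)"
  using cinner_scaleC_left[of c y x]
  by (simp add: cinner_commute[of x "c *\<^sub>C y"] cinner_commute[of x y])

lemma cinner_zero [simp]:
  "cinner 0 x = 0" "cinner x 0 = 0" for x :: "'a::cinner_space"
  using cinner_add_left[of 0 0 x] cinner_add_right[of x 0 0] by simp_all

lemma scaleC_zero_right [simp]: "c *\<^sub>C (0 :: 'a::cinner_space) = 0"
  using scaleC_add_right[of c 0 "0 :: 'a"] by simp

lemma cinner_sum_left: "cinner (\<Sum>i\<in>F. g i) y = (\<Sum>i\<in>F. cinner (g i) (y :: 'a::cinner_space))"
  by (induction F rule: infinite_finite_induct) (simp_all add: cinner_add_left)

lemma cinner_sum_right: "cinner y (\<Sum>i\<in>F. g i) = (\<Sum>i\<in>F. cinner y (g i :: 'a::cinner_space))"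
  by (induction F rule: infinite_finite_induct) (simp_all add: cinner_add_right)

lemma bounded_clinearI:
  fixes A :: "'a::cinner_space \<Rightarrow> 'b::cinner_space"
  assumes "\<And>x y. A (x + y) = A x + A y"
    and "\<And>c x. A (c *\<^sub>C x) = c *\<^sub>C A x"
    and "\<And>x. norm (A x) \<le> norm x * K"
  shows "bounded_clinear A"
  unfolding bounded_clinear_def
  by (auto intro!: bounded_linear_intro[where K = K] assms simp: scaleR_scaleC)

lemma bounded_clinear_compose:
  assumes "bounded_clinear A" "bounded_clinear B"
  shows "bounded_clinear (A \<circ> B)"
  using assms unfolding bounded_clinear_def o_def by (auto intro: bounded_linear_compose)

lemma bounded_clinear_add: "bounded_clinear A \<Longrightarrow> A (x + y) = A x + A y"
  by (simp add: bounded_clinear_def linear_simps)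

lemma bounded_clinear_scaleC: "bounded_clinear A \<Longrightarrow> A (c *\<^sub>C x) = c *\<^sub>C A x"
  by (simp add: bounded_clinear_def)

lemma bounded_clinear_sum: "bounded_clinear A \<Longrightarrow> A (\<Sum>i\<in>F. g i) = (\<Sum>i\<in>F. A (g i))"
  unfolding bounded_clinear_def by (simp add: bounded_linear.linear linear_sum)

lemma Re_cinner_polarization:
  fixes x y :: "'a::cinner_space"
  shows "2 * Re (cinner x y) = (norm (x + y))\<^sup>2 - (norm x)\<^sup>2 - (norm y)\<^sup>2"
proof -
  have "complex_of_real ((norm (x + y))\<^sup>2) =
      complex_of_real ((norm x)\<^sup>2) + complex_of_real ((norm y)\<^sup>2) + (cinner x y + cnj (cinner x y))"
    by (simp only: cinner_self[symmetric] cinner_add_left cinner_add_right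
        cinner_commute[of y x] Groups.add_ac)
  then show ?thesis
    by (simp add: complex_eq_iff)
qed

text \<open>The norm determines the inner product by polarization, so an isometry preserves it.\<close>

lemma unitaryI:
  fixes U :: "'a::cinner_space \<Rightarrow> 'b::cinner_space"
  assumes add: "\<And>x y. U (x + y) = U x + U y"
    and scale: "\<And>c x. U (c *\<^sub>C x) = c *\<^sub>C U x"
    and iso: "\<And>x. norm (U x) = norm x"
    and surj: "surj U"
  shows "unitary U"
proof -
  have re: "Re (cinner (U x) (U y)) = Re (cinner x y)" for x y
    using Re_cinner_polarization[of "U x" "U y"] Re_cinner_polarization[of x y]
    by (simp add: iso flip: add)
  have im: "Im (cinner (U x) (U y)) = Im (cinner x y)" for x y
    using re[of "\<i> *\<^sub>C x" y] by (simp add: scale cinner_scaleC_left)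
  show ?thesis
    unfolding unitary_def
    using bounded_clinearI[of U 1] add scale iso surj re im by (simp add: complex_eq_iff)
qed

lemma unitary_norm: "unitary U \<Longrightarrow> norm (U x) = norm x"
  unfolding unitary_def using cinner_self[of "U x"] cinner_self[of x]
  by (smt (verit) norm_ge_zero of_real_eq_iff power2_eq_imp_eq)

lemma unitary_bounded_clinear: "unitary U \<Longrightarrow> bounded_clinear U"
  by (simp add: unitary_def)

lemma unitary_bij: "unitary U \<Longrightarrow> bij U"
proof (rule bijI)
  assume U: "unitary U"
  show "inj U"
  proof (rule injI)
    fix x y assume "U x = U y"
    then have "U (x - y) = 0"
      using U by (simp add: unitary_def bounded_clinear_def linear_simps)
    then show "x = y"
      using unitary_norm[OF U, of "x - y"] by simp
  qed
qed (simp add: unitary_def)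

lemma unitary_inv_f: "unitary U \<Longrightarrow> U (inv U y) = y"
  using unitary_bij by (metis bij_inv_eq_iff)

lemma unitary_inv_inv: "unitary U \<Longrightarrow> inv U (U x) = x"
  using unitary_bij by (metis bij_inv_eq_iff)

lemma unitary_inv:
  assumes U: "unitary U"
  shows "unitary (inv U)"
proof (rule unitaryI)
  have inj: "inj U" using unitary_bij[OF U] by (simp add: bij_def)
  note [simp] = unitary_inv_f[OF U] unitary_inv_inv[OF U]
  show "inv U (x + y) = inv U x + inv U y" for x y
    by (rule injD[OF inj]) (simp add: bounded_clinear_add[OF unitary_bounded_clinear[OF U]])
  show "inv U (c *\<^sub>C x) = c *\<^sub>C inv U x" for c x
    by (rule injD[OF inj]) (simp add: bounded_clinear_scaleC[OF unitary_bounded_clinear[OF U]])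
  show "norm (inv U x) = norm x" for x
    using unitary_norm[OF U, of "inv U x"] by simp
  show "surj (inv U)"
    by (rule surjI[of _ U]) simp
qed

lemma unitary_compose:
  assumes "unitary U" "unitary V"
  shows "unitary (U \<circ> V)"
  using assms comp_surj[of V U] by (simp add: unitary_def bounded_clinear_compose)



section \<open>Bounded operators and bounded sesquilinear forms\<close>

lemma Abs_l2sum_coord:
  assumes "\<And>F. finite F \<Longrightarrow> (\<Sum>i\<in>F. (norm (x i))\<^sup>2) \<le> B"
  shows "coord (Abs_l2sum x) = x"
proof -
  have "(\<lambda>i. (norm (x i))\<^sup>2) summable_on UNIV"
    by (rule nonneg_bounded_partial_sums_imp_summable_on[of _ _ B])
      (auto intro: assms eventually_finite_subsets_at_top_weakI)
  then show ?thesis by (simp add: Abs_l2sum_inverse)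
qed

lemma norm_l2sum_sq_le:
  assumes "\<And>F. finite F \<Longrightarrow> (\<Sum>i\<in>F. (norm (coord x i))\<^sup>2) \<le> B"
  shows "(norm x)\<^sup>2 \<le> B"
  unfolding norm_sq_l2sum by (rule infsum_le_finite_sums[OF l2_summable]) (rule assms)

lemma sum_norm_sq_le_norm_sq:
  "finite F \<Longrightarrow> (\<Sum>i\<in>F. (norm (coord x i))\<^sup>2) \<le> (norm x)\<^sup>2"
  unfolding norm_sq_l2sum by (rule finite_sum_le_infsum) (auto intro: l2_summable)

text \<open>The bound is by the sum of the squared norms instead of the product of the norms; by scaling
  this is equivalent up to the constant, and it makes the inequality of arithmetic and geometric
  means sufficient where the Cauchy-Schwarz inequality would otherwise be needed.\<close>

definition form_bounded :: "('x \<Rightarrow> 'y \<Rightarrow> complex) \<Rightarrow> real \<Rightarrow> bool"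
  where "form_bounded K C \<longleftrightarrow> (\<forall>F G c d. finite F \<longrightarrow> finite G \<longrightarrow>
    cmod (\<Sum>x\<in>F. \<Sum>y\<in>G. K x y * c y * cnj (d x))
      \<le> C * ((\<Sum>y\<in>G. (cmod (c y))\<^sup>2) + (\<Sum>x\<in>F. (cmod (d x))\<^sup>2)))"

lemma form_boundedD:
  "form_bounded K C \<Longrightarrow> finite F \<Longrightarrow> finite G \<Longrightarrow>
    cmod (\<Sum>x\<in>F. \<Sum>y\<in>G. K x y * c y * cnj (d x))
      \<le> C * ((\<Sum>y\<in>G. (cmod (c y))\<^sup>2) + (\<Sum>x\<in>F. (cmod (d x))\<^sup>2))"
  unfolding form_bounded_def by blast

lemma form_bounded_pos:
  fixes K :: "'x \<Rightarrow> 'y \<Rightarrow> complex"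
  assumes "form_bounded K C"
  shows "\<exists>D>0. form_bounded K D"
proof -
  have "form_bounded K (max C 1)"
    unfolding form_bounded_def
  proof (intro allI impI)
    fix F :: "'x set" and G :: "'y set" and c d assume "finite F" "finite G"
    from form_boundedD[OF assms this, of c d]
    show "cmod (\<Sum>x\<in>F. \<Sum>y\<in>G. K x y * c y * cnj (d x))
        \<le> max C 1 * ((\<Sum>y\<in>G. (cmod (c y))\<^sup>2) + (\<Sum>x\<in>F. (cmod (d x))\<^sup>2))"
      using mult_right_mono[of C "max C 1" "(\<Sum>y\<in>G. (cmod (c y))\<^sup>2) + (\<Sum>x\<in>F. (cmod (d x))\<^sup>2)"]
      by (simp add: sum_nonneg)
  qed
  then show ?thesis by (intro exI[of _ "max C 1"]) simp
qed

text \<open>The dual form of the bound: test the form with \<open>d = t \<cdot> K c\<close>.  The quadratic term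
  \<open>C t\<^sup>2 |K c|\<^sup>2\<close> on the right is absorbed by the left side \<open>t |K c|\<^sup>2\<close> for small \<open>t\<close>.\<close>

lemma form_bounded_apply:
  assumes K: "form_bounded K C" and C: "C > 0" and F: "finite F" and G: "finite G"
  shows "(\<Sum>x\<in>F. (cmod (\<Sum>y\<in>G. K x y * c y))\<^sup>2) \<le> 4 * C\<^sup>2 * (\<Sum>y\<in>G. (cmod (c y))\<^sup>2)"
proof -
  \<comment> \<open>this \<open>t\<close> maximizes \<open>t - C t\<^sup>2\<close>\<close>
  define t where "t = 1 / (2 * C)"
  define T where "T x = (\<Sum>y\<in>G. K x y * c y)" for x
  let ?S = "\<Sum>x\<in>F. (cmod (T x))\<^sup>2" and ?c = "\<Sum>y\<in>G. (cmod (c y))\<^sup>2"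
  have "(\<Sum>x\<in>F. \<Sum>y\<in>G. K x y * c y * cnj (of_real t * T x)) = (\<Sum>x\<in>F. T x * cnj (of_real t * T x))"
    by (simp add: T_def sum_distrib_right)
  also have "\<dots> = (\<Sum>x\<in>F. of_real (t * (cmod (T x))\<^sup>2))"
    by (intro sum.cong refl) (simp add: complex_norm_square mult_ac flip: of_real_power)
  also have "\<dots> = of_real (t * ?S)"
    by (simp add: sum_distrib_left)
  finally have "\<bar>t * ?S\<bar> \<le> C * (?c + (\<Sum>x\<in>F. (cmod (of_real t * T x))\<^sup>2))"
    using form_boundedD[OF K F G, of c "\<lambda>x. of_real t * T x"] by (simp only: norm_of_real)
  also have "(\<Sum>x\<in>F. (cmod (of_real t * T x))\<^sup>2) = t\<^sup>2 * ?S"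
    by (simp add: norm_mult power_mult_distrib sum_distrib_left)
  finally have "t * ?S \<le> C * ?c + C * t\<^sup>2 * ?S"
    by (simp add: algebra_simps)
  then have "?S \<le> 4 * C\<^sup>2 * ?c"
    using C by (simp add: t_def field_simps power2_eq_square)
  then show ?thesis unfolding T_def .
qed

lemma form_bounded_row:
  assumes K: "form_bounded K C" and C: "C > 0" and G: "finite G"
  shows "(\<Sum>y\<in>G. (cmod (K x y))\<^sup>2) \<le> 4 * C\<^sup>2"
proof -
  let ?S = "\<Sum>y\<in>G. (cmod (K x y))\<^sup>2"
  have "(\<Sum>y\<in>G. K x y * cnj (K x y)) = of_real ?S"
    by (simp add: complex_norm_square of_real_sum del: of_real_power)
  then have "(cmod (\<Sum>y\<in>G. K x y * cnj (K x y)))\<^sup>2 = ?S\<^sup>2"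
    by (simp only: norm_of_real power2_abs)
  then have "?S\<^sup>2 \<le> 4 * C\<^sup>2 * ?S"
    using form_bounded_apply[OF K C _ G, of "{x}" "\<lambda>y. cnj (K x y)"] by simp
  moreover have "?S \<ge> 0" by (simp add: sum_nonneg)
  ultimately show ?thesis
    by (smt (verit) mult_right_le_imp_le power2_eq_square zero_le_power2)
qed

text \<open>The rows of a form bounded kernel are square summable, so the kernel acts on every
  \<open>\<phi>\<close> by inner products with the rows; this makes linearity immediate, and the bound passes from
  finite sums to the limit.\<close>

lemma form_bounded_imp_bounded_operator:
  fixes K :: "'x \<Rightarrow> 'x \<Rightarrow> complex"
  assumes "form_bounded K C0"
  shows "defines_bounded_operator K"
proof -
  obtain C where K: "form_bounded K C" and C: "C > 0"
    using form_bounded_pos[OF assms] by blast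
  define r where "r x = (Abs_l2sum (\<lambda>y. cnj (K x y)) :: 'x ell2)" for x
  have r: "coord (r x) y = cnj (K x y)" for x y
    unfolding r_def by (subst Abs_l2sum_coord) (use form_bounded_row[OF K C] in auto)
  define A where "A \<phi> = (Abs_l2sum (\<lambda>x. cinner \<phi> (r x)) :: 'x ell2)" for \<phi>
  have bd: "(\<Sum>x\<in>F. (cmod (cinner \<phi> (r x)))\<^sup>2) \<le> 4 * C\<^sup>2 * (norm \<phi>)\<^sup>2" if F: "finite F" for F \<phi>
  proof (rule tendsto_upperbound)
    show "((\<lambda>G. \<Sum>x\<in>F. (cmod (\<Sum>y\<in>G. K x y * coord \<phi> y))\<^sup>2) \<longlongrightarrow>
        (\<Sum>x\<in>F. (cmod (cinner \<phi> (r x)))\<^sup>2)) (finite_subsets_at_top UNIV)"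
    proof (intro tendsto_intros)
      fix x
      have "((\<lambda>y. cinner (coord \<phi> y) (coord (r x) y)) has_sum cinner \<phi> (r x)) UNIV"
        unfolding cinner_l2sum_def by (rule has_sum_infsum[OF l2_cinner_summable])
      then show "((\<lambda>G. \<Sum>y\<in>G. K x y * coord \<phi> y) \<longlongrightarrow> cinner \<phi> (r x)) (finite_subsets_at_top UNIV)"
        by (simp add: has_sum_def cinner_complex_def r mult.commute)
    qed
    show "\<forall>\<^sub>F G in finite_subsets_at_top UNIV.
        (\<Sum>x\<in>F. (cmod (\<Sum>y\<in>G. K x y * coord \<phi> y))\<^sup>2) \<le> 4 * C\<^sup>2 * (norm \<phi>)\<^sup>2"
    proof (rule eventually_finite_subsets_at_top_weakI)
      fix G :: "'x set" assume G: "finite G"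
      have "(\<Sum>y\<in>G. (cmod (coord \<phi> y))\<^sup>2) \<le> (norm \<phi>)\<^sup>2"
        by (rule sum_norm_sq_le_norm_sq[OF G])
      then show "(\<Sum>x\<in>F. (cmod (\<Sum>y\<in>G. K x y * coord \<phi> y))\<^sup>2) \<le> 4 * C\<^sup>2 * (norm \<phi>)\<^sup>2"
        using form_bounded_apply[OF K C F G, of "coord \<phi>"]
        by (smt (verit) mult_left_mono zero_le_power2)
    qed
  qed simp
  have A: "coord (A \<phi>) x = cinner \<phi> (r x)" for \<phi> x
    unfolding A_def by (subst Abs_l2sum_coord) (use bd in auto)
  have "bounded_clinear A"
  proof (rule bounded_clinearI)
    fix \<phi>
    have "(norm (A \<phi>))\<^sup>2 \<le> 4 * C\<^sup>2 * (norm \<phi>)\<^sup>2"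
      by (rule norm_l2sum_sq_le) (simp add: A bd)
    also have "\<dots> = (norm \<phi> * (2 * C))\<^sup>2" by (simp add: power_mult_distrib)
    finally show "norm (A \<phi>) \<le> norm \<phi> * (2 * C)"
      by (rule power2_le_imp_le) (use C in simp)
  qed (auto intro!: l2sum_eqI simp: A cinner_add_left cinner_scaleC_left scaleC_complex_def)
  moreover have "kernel_of A = K"
  proof (intro ext)
    fix x y
    have "kernel_of A x y = cnj (cinner (r x) (delta y))"
      unfolding kernel_of_def by (subst cinner_delta, subst A, rule cinner_commute)
    then show "kernel_of A x y = K x y" by (simp add: cinner_delta r)
  qed
  ultimately show ?thesis unfolding defines_bounded_operator_def by blast
qed

lemma bounded_operator_imp_form_bounded:
  fixes K :: "'x \<Rightarrow> 'x \<Rightarrow> complex"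
  assumes "defines_bounded_operator K"
  shows "\<exists>C. form_bounded K C"
proof -
  obtain A where A: "bounded_clinear A" and K: "kernel_of A = K"
    using assms unfolding defines_bounded_operator_def by blast
  obtain B where B: "norm (A x) \<le> norm x * B" for x
    using A bounded_linear.bounded unfolding bounded_clinear_def by blast
  have "form_bounded K (B\<^sup>2 + 1)"
    unfolding form_bounded_def
  proof (intro allI impI)
    fix F G :: "'x set" and c d :: "'x \<Rightarrow> complex"
    assume F: "finite F" and G: "finite G"
    define v where "v H e = (\<Sum>x\<in>H. e x *\<^sub>C delta x)" for H :: "'x set" and e :: "'x \<Rightarrow> complex"
    have nv: "(norm (v H e))\<^sup>2 = (\<Sum>x\<in>H. (cmod (e x))\<^sup>2)" if "finite H" for H e
    proof -
      have "cinner (v H e) (v H e) = (\<Sum>x\<in>H. cnj (e x) * coord (v H e) x)"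
        by (subst (2) v_def) (simp add: cinner_sum_right cinner_scaleC_right cinner_delta)
      also have "\<dots> = (\<Sum>x\<in>H. of_real ((cmod (e x))\<^sup>2))"
        by (intro sum.cong refl)
          (use that in \<open>simp add: v_def coord_sum coord_delta scaleC_complex_def if_distrib
            complex_norm_square mult.commute del: of_real_power cong: if_cong\<close>)
      finally show ?thesis
        unfolding cinner_self by (simp only: of_real_sum[symmetric] of_real_eq_iff)
    qed
    have "cinner (A (v G c)) (v F d) = (\<Sum>x\<in>F. \<Sum>y\<in>G. K x y * c y * cnj (d x))"
      unfolding v_def K[symmetric] kernel_of_def
      by (simp add: bounded_clinear_sum[OF A] bounded_clinear_scaleC[OF A] cinner_sum_right
          cinner_sum_left cinner_scaleC_left cinner_scaleC_right sum_distrib_left mult_ac)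
    then have "cmod (\<Sum>x\<in>F. \<Sum>y\<in>G. K x y * c y * cnj (d x)) \<le> (norm (A (v G c)))\<^sup>2 + (norm (v F d))\<^sup>2"
      using cmod_cinner_le[of "A (v G c)" "v F d"] by simp
    also have "(norm (A (v G c)))\<^sup>2 \<le> (norm (v G c) * B)\<^sup>2"
      by (rule power_mono[OF B]) simp
    also have "(norm (v G c) * B)\<^sup>2 + (norm (v F d))\<^sup>2
        \<le> (B\<^sup>2 + 1) * ((norm (v G c))\<^sup>2 + (norm (v F d))\<^sup>2)"
      by (simp add: algebra_simps power_mult_distrib)
    finally show "cmod (\<Sum>x\<in>F. \<Sum>y\<in>G. K x y * c y * cnj (d x))
        \<le> (B\<^sup>2 + 1) * ((\<Sum>y\<in>G. (cmod (c y))\<^sup>2) + (\<Sum>x\<in>F. (cmod (d x))\<^sup>2))"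
      by (simp only: nv[OF F] nv[OF G])
  qed
  then show ?thesis ..
qed

text \<open>A compression to a subset of the coordinates; it extracts the Toeplitz matrix from a word
  kernel.\<close>

lemma form_bounded_reindex:
  fixes K :: "'a \<Rightarrow> 'a \<Rightarrow> complex" and i :: "'b \<Rightarrow> 'a"
  assumes K: "form_bounded K C" and i: "inj i"
  shows "form_bounded (\<lambda>x y. K (i x) (i y)) C"
  unfolding form_bounded_def
proof (intro allI impI)
  fix F G :: "'b set" and c d assume "finite F" "finite G"
  then have fin: "finite (i ` F)" "finite (i ` G)" by auto
  have "inj_on i F" "inj_on i G" using i by (auto intro: inj_on_subset)
  then show "cmod (\<Sum>x\<in>F. \<Sum>y\<in>G. K (i x) (i y) * c y * cnj (d x))
      \<le> C * ((\<Sum>y\<in>G. (cmod (c y))\<^sup>2) + (\<Sum>x\<in>F. (cmod (d x))\<^sup>2))"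
    using form_boundedD[OF K fin, of "c \<circ> inv i" "d \<circ> inv i"]
    by (simp add: sum.reindex inv_f_f[OF i])
qed

section \<open>Bounded symbols give bounded Toeplitz matrices\<close>

abbreviation circle_measure :: "real measure"
  where "circle_measure \<equiv> lebesgue_on {0..2 * pi}"

lemma finite_measure_circle: "finite_measure circle_measure"
  by (rule finite_measure_lebesgue_on) simp

lemma circle_measurable: "f \<in> borel_measurable lebesgue \<Longrightarrow> f \<in> borel_measurable circle_measure"
  by (rule measurable_restrict_space1)

lemma continuous_circle_measurable:
  fixes f :: "real \<Rightarrow> 'a::euclidean_space"
  assumes "continuous_on UNIV f"
  shows "f \<in> borel_measurable lebesgue"
  using continuous_imp_measurable_on_sets_lebesgue[OF assms] by (simp add: lebesgue_on_UNIV_eq)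

lemma continuous_circle_integrable:
  fixes f :: "real \<Rightarrow> 'a::euclidean_space"
  assumes "continuous_on UNIV f"
  shows "integrable circle_measure f"
  using continuous_imp_integrable[of 0 "2 * pi" f] continuous_on_subset[OF assms]
  by simp

lemma bounded_circle_integrable:
  fixes f :: "real \<Rightarrow> complex"
  assumes "f \<in> borel_measurable lebesgue" "AE \<theta> in circle_measure. cmod (f \<theta>) \<le> B"
  shows "integrable circle_measure f"
  by (rule finite_measure.integrable_const_bound[OF finite_measure_circle assms(2)])
    (rule circle_measurable[OF assms(1)])

lemma fourier_coeff_circle:
  "fourier_coeff g n = (LINT \<theta>|circle_measure. g \<theta> * cis (- (of_int n * \<theta>))) / of_real (2 * pi)"
  unfolding fourier_coeff_def set_lebesgue_integral_def by (subst integral_restrict_space) auto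

text \<open>Orthogonality of the characters of the circle.\<close>

lemma integral_cis_int:
  "(LINT \<theta>|circle_measure. cis (of_int n * \<theta>)) = (if n = 0 then of_real (2 * pi) else 0)"
proof (cases "n = 0")
  case True
  then show ?thesis
    by (simp add: measure_restrict_space scaleR_conv_of_real)
next
  case False
  have "((\<lambda>\<theta>. cis (of_int n * \<theta>)) has_integral
      (cis (of_int n * (2 * pi)) / (\<i> * of_int n) - cis (of_int n * 0) / (\<i> * of_int n))) {0..2 * pi}"
  proof (rule fundamental_theorem_of_calculus)
    fix x assume "x \<in> {0..2 * pi}"
    show "((\<lambda>\<theta>. cis (of_int n * \<theta>) / (\<i> * of_int n)) has_vector_derivative cis (of_int n * x))
        (at x within {0..2 * pi})"
      unfolding has_vector_derivative_def
      by (rule derivative_eq_intros refl)+ (use False in \<open>auto simp: fun_eq_iff scaleR_conv_of_real field_simps\<close>)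
  qed simp
  moreover have "cis (of_int n * (2 * pi)) = 1"
    using cis_multiple_2pi[of "of_int n"] by (simp add: mult_ac)
  ultimately have "integral {0..2 * pi} (\<lambda>\<theta>. cis (of_int n * \<theta>)) = 0"
    by (simp add: integral_unique)
  moreover have "(LINT \<theta>|circle_measure. cis (of_int n * \<theta>)) = integral {0..2 * pi} (\<lambda>\<theta>. cis (of_int n * \<theta>))"
    by (rule lebesgue_integral_eq_integral) (auto intro!: continuous_circle_integrable continuous_intros)
  ultimately show ?thesis using False by simp
qed

lemma integral_double_sum:
  fixes h :: "'i \<Rightarrow> 'j \<Rightarrow> 'a \<Rightarrow> complex"
  assumes h: "\<And>i j. integrable M (h i j)"
  shows "(LINT \<theta>|M. (\<Sum>i\<in>I. \<Sum>j\<in>J. a i j * h i j \<theta>)) = (\<Sum>i\<in>I. \<Sum>j\<in>J. a i j * (LINT \<theta>|M. h i j \<theta>))"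
proof -
  have [simp]: "integrable M (\<lambda>\<theta>. a i j * h i j \<theta>)" for i j
    using h by (rule Bochner_Integration.integrable_mult_right)
  show ?thesis
    by (simp add: Bochner_Integration.integral_sum Bochner_Integration.integrable_sum)
qed

lemma parseval_trig_polynomial:
  fixes c :: "'i \<Rightarrow> complex" and \<nu> :: "'i \<Rightarrow> int"
  assumes I: "finite I" and \<nu>: "inj_on \<nu> I"
  shows "(LINT \<theta>|circle_measure. (cmod (\<Sum>i\<in>I. c i * cis (of_int (\<nu> i) * \<theta>)))\<^sup>2)
    = 2 * pi * (\<Sum>i\<in>I. (cmod (c i))\<^sup>2)"
proof -
  have "complex_of_real (LINT \<theta>|circle_measure. (cmod (\<Sum>i\<in>I. c i * cis (of_int (\<nu> i) * \<theta>)))\<^sup>2)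
      = (LINT \<theta>|circle_measure. complex_of_real ((cmod (\<Sum>i\<in>I. c i * cis (of_int (\<nu> i) * \<theta>)))\<^sup>2))"
    by (simp only: integral_complex_of_real)
  also have "\<dots> = (LINT \<theta>|circle_measure. (\<Sum>i\<in>I. \<Sum>j\<in>I. c i * cnj (c j) * cis (of_int (\<nu> i - \<nu> j) * \<theta>)))"
  proof (intro Bochner_Integration.integral_cong refl)
    fix \<theta>
    have "cis (of_int (\<nu> i - \<nu> j) * \<theta>) = cis (of_int (\<nu> i) * \<theta>) * cnj (cis (of_int (\<nu> j) * \<theta>))" for i j
      by (simp add: cis_cnj cis_mult left_diff_distrib)
    then show "complex_of_real ((cmod (\<Sum>i\<in>I. c i * cis (of_int (\<nu> i) * \<theta>)))\<^sup>2)
        = (\<Sum>i\<in>I. \<Sum>j\<in>I. c i * cnj (c j) * cis (of_int (\<nu> i - \<nu> j) * \<theta>))"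
      unfolding complex_norm_square cnj_sum complex_cnj_mult sum_product by (simp add: mult_ac)
  qed
  also have "\<dots> = (\<Sum>i\<in>I. \<Sum>j\<in>I. c i * cnj (c j) * (LINT \<theta>|circle_measure. cis (of_int (\<nu> i - \<nu> j) * \<theta>)))"
    by (rule integral_double_sum) (intro continuous_circle_integrable continuous_intros)
  also have "\<dots> = (\<Sum>i\<in>I. \<Sum>j\<in>I. if i = j then c i * cnj (c j) * of_real (2 * pi) else 0)"
    unfolding integral_cis_int by (intro sum.cong refl) (use \<nu> in \<open>auto simp: inj_on_eq_iff\<close>)
  also have "\<dots> = of_real (2 * pi * (\<Sum>i\<in>I. (cmod (c i))\<^sup>2))"
    using I by (simp add: complex_norm_square sum_distrib_left mult_ac del: of_real_power)
  finally show ?thesis by (simp only: of_real_eq_iff)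
qed

text \<open>With \<open>p\<^sub>c\<close> the trigonometric polynomial with coefficients \<open>c\<close>, the Toeplitz form at \<open>c, d\<close> is
  the mean of \<open>g p\<^sub>c \<close> times the conjugate of \<open>p\<^sub>d\<close>.  The integrand is bounded by
  \<open>B (|p\<^sub>c|\<^sup>2 + |p\<^sub>d|\<^sup>2) / 2\<close>, whose mean Parseval's identity computes.\<close>

lemma Linf_series_imp_form_bounded:
  assumes "f \<in> Linf_series"
  shows "\<exists>C. form_bounded (Gamma_nat f) C"
proof -
  obtain g B where gm: "g \<in> borel_measurable lebesgue" and gB: "AE \<theta> in lebesgue. cmod (g \<theta>) \<le> B"
    and f: "f = fourier_coeff g"
    using assms unfolding Linf_series_def Linf_circle_def by auto
  have gB': "AE \<theta> in circle_measure. cmod (g \<theta>) \<le> B"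
    using gB by (subst AE_restrict_space_iff) auto
  have int: "integrable circle_measure (\<lambda>\<theta>. g \<theta> * h \<theta>)" if h: "continuous_on UNIV h" for h
  proof -
    have "compact (h ` {0..2 * pi})"
      by (rule compact_continuous_image) (use h continuous_on_subset in auto)
    then obtain B' where "cmod z \<le> B'" if "z \<in> h ` {0..2 * pi}" for z
      using compact_imp_bounded bounded_iff by metis
    then have B': "cmod (h \<theta>) \<le> B'" if "\<theta> \<in> {0..2 * pi}" for \<theta>
      using that by auto
    show ?thesis
    proof (rule bounded_circle_integrable)
      show "(\<lambda>\<theta>. g \<theta> * h \<theta>) \<in> borel_measurable lebesgue"
        using gm continuous_circle_measurable[OF h] by simp
      show "AE \<theta> in circle_measure. cmod (g \<theta> * h \<theta>) \<le> B * B'"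
        using gB' AE_space
      proof eventually_elim
        case (elim \<theta>)
        then show ?case
          using B'[of \<theta>] by (auto simp: norm_mult intro!: mult_mono order_trans[OF norm_ge_zero elim(1)])
      qed
    qed
  qed
  have "form_bounded (Gamma_nat f) (B / 2)"
    unfolding form_bounded_def
  proof (intro allI impI)
    fix F G :: "nat set" and c d :: "nat \<Rightarrow> complex"
    assume F: "finite F" and G: "finite G"
    define p where "p H e \<theta> = (\<Sum>n\<in>H. e n * cis (of_int (int n) * \<theta>))" for H e \<theta>
    have pc: "continuous_on UNIV (p H e)" for H e
      unfolding p_def by (intro continuous_intros)
    have pn: "(LINT \<theta>|circle_measure. (cmod (p H e \<theta>))\<^sup>2) = 2 * pi * (\<Sum>i\<in>H. (cmod (e i))\<^sup>2)"
      if "finite H" for H e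
      unfolding p_def using that by (rule parseval_trig_polynomial) (simp add: inj_on_def)
    have pi2: "integrable circle_measure (\<lambda>\<theta>. (cmod (p H e \<theta>))\<^sup>2)" for H e
      by (intro continuous_circle_integrable continuous_intros pc)
    have "(\<Sum>x\<in>F. \<Sum>y\<in>G. Gamma_nat f x y * c y * cnj (d x)) * of_real (2 * pi)
        = (\<Sum>x\<in>F. \<Sum>y\<in>G. c y * cnj (d x) * (LINT \<theta>|circle_measure. g \<theta> * cis (- (of_int (int x - int y) * \<theta>))))"
      unfolding sum_distrib_right
      by (intro sum.cong refl) (simp add: Gamma_nat_def f fourier_coeff_circle)
    also have "\<dots> = (LINT \<theta>|circle_measure. (\<Sum>x\<in>F. \<Sum>y\<in>G. c y * cnj (d x) * (g \<theta> * cis (- (of_int (int x - int y) * \<theta>)))))"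
      by (rule integral_double_sum[symmetric]) (intro int continuous_intros)
    also have "\<dots> = (LINT \<theta>|circle_measure. g \<theta> * (p G c \<theta> * cnj (p F d \<theta>)))"
    proof (intro Bochner_Integration.integral_cong refl)
      fix \<theta>
      have "cis (- (of_int (int x - int y) * \<theta>)) = cis (of_int (int y) * \<theta>) * cnj (cis (of_int (int x) * \<theta>))" for x y
        by (simp add: cis_cnj cis_mult left_diff_distrib)
      then show "(\<Sum>x\<in>F. \<Sum>y\<in>G. c y * cnj (d x) * (g \<theta> * cis (- (of_int (int x - int y) * \<theta>))))
          = g \<theta> * (p G c \<theta> * cnj (p F d \<theta>))"
        unfolding p_def cnj_sum complex_cnj_mult sum_product
        by (subst sum.swap) (simp add: sum_distrib_left mult_ac)
    qed
    finally have eq: "(\<Sum>x\<in>F. \<Sum>y\<in>G. Gamma_nat f x y * c y * cnj (d x)) * of_real (2 * pi)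
        = (LINT \<theta>|circle_measure. g \<theta> * (p G c \<theta> * cnj (p F d \<theta>)))" .
    have "cmod (LINT \<theta>|circle_measure. g \<theta> * (p G c \<theta> * cnj (p F d \<theta>)))
        \<le> (LINT \<theta>|circle_measure. B / 2 * ((cmod (p G c \<theta>))\<^sup>2 + (cmod (p F d \<theta>))\<^sup>2))"
    proof (rule order_trans[OF integral_norm_bound], rule integral_mono_AE)
      show "integrable circle_measure (\<lambda>\<theta>. cmod (g \<theta> * (p G c \<theta> * cnj (p F d \<theta>))))"
        by (intro integrable_norm int continuous_intros pc)
      show "integrable circle_measure (\<lambda>\<theta>. B / 2 * ((cmod (p G c \<theta>))\<^sup>2 + (cmod (p F d \<theta>))\<^sup>2))"
        by (intro Bochner_Integration.integrable_mult_right Bochner_Integration.integrable_add pi2)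
      have "AE \<theta> in circle_measure. cmod (g \<theta> * (p G c \<theta> * cnj (p F d \<theta>)))
          \<le> B / 2 * ((cmod (p G c \<theta>))\<^sup>2 + (cmod (p F d \<theta>))\<^sup>2)"
        using gB'
      proof eventually_elim
        case (elim \<theta>)
        have "cmod (p G c \<theta>) * cmod (p F d \<theta>) \<le> ((cmod (p G c \<theta>))\<^sup>2 + (cmod (p F d \<theta>))\<^sup>2) / 2"
          using sum_squares_bound[of "cmod (p G c \<theta>)" "cmod (p F d \<theta>)"] by simp
        then have "cmod (g \<theta>) * (cmod (p G c \<theta>) * cmod (p F d \<theta>))
            \<le> B * (((cmod (p G c \<theta>))\<^sup>2 + (cmod (p F d \<theta>))\<^sup>2) / 2)"
          by (intro mult_mono elim order_trans[OF norm_ge_zero elim]) auto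
        then show ?case by (simp add: norm_mult)
      qed
      then show "AE \<theta> in circle_measure. cmod (g \<theta> * (p G c \<theta> * cnj (p F d \<theta>)))
          \<le> B / 2 * ((cmod (p G c \<theta>))\<^sup>2 + (cmod (p F d \<theta>))\<^sup>2)" .
    qed
    also have "\<dots> = B / 2 * ((\<Sum>y\<in>G. (cmod (c y))\<^sup>2) + (\<Sum>x\<in>F. (cmod (d x))\<^sup>2)) * (2 * pi)"
      unfolding integral_mult_right_zero Bochner_Integration.integral_add[OF pi2 pi2] pn[OF F] pn[OF G]
      by (simp add: algebra_simps)
    finally show "cmod (\<Sum>x\<in>F. \<Sum>y\<in>G. Gamma_nat f x y * c y * cnj (d x))
        \<le> B / 2 * ((\<Sum>y\<in>G. (cmod (c y))\<^sup>2) + (\<Sum>x\<in>F. (cmod (d x))\<^sup>2))"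
      unfolding eq[symmetric] norm_mult norm_of_real by simp
  qed
  then show ?thesis ..
qed

section \<open>Bounded Toeplitz matrices have bounded symbols\<close>

text \<open>The weight is \<open>max 0 (1 - |n| / N)\<close>, written as the number of entries on the diagonal
  \<open>k - l = n\<close> of an \<open>N \<times> N\<close> matrix, divided by \<open>N\<close>, because the Fejer mean arises by summing a
  Toeplitz matrix along its diagonals.\<close>

definition fejer_weight :: "nat \<Rightarrow> int \<Rightarrow> real"
  where "fejer_weight N n =
    real (card {p \<in> {..<N} \<times> {..<N}. int (fst p) - int (snd p) = n}) / real N"

definition fejer_mean :: "fourier_series \<Rightarrow> nat \<Rightarrow> real \<Rightarrow> complex"
  where "fejer_mean f N \<theta> =
    (\<Sum>n\<in>{- int N..int N}. of_real (fejer_weight N n) * f n * cis (of_int n * \<theta>))"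

lemma fejer_weight_eq_0: "n \<notin> {- int N..int N} \<Longrightarrow> fejer_weight N n = 0"
proof -
  assume "n \<notin> {- int N..int N}"
  then have "{p \<in> {..<N} \<times> {..<N}. int (fst p) - int (snd p) = n} = {}" by auto
  then show ?thesis by (simp only: fejer_weight_def card.empty of_nat_0 div_0)
qed

lemma fejer_weight_le_1: "fejer_weight N n \<le> 1"
proof -
  have "card {p \<in> {..<N} \<times> {..<N}. int (fst p) - int (snd p) = n} \<le> card {..<N}"
    by (rule card_inj_on_le[of fst]) (auto simp: inj_on_def)
  then show ?thesis by (cases "N = 0") (simp_all add: fejer_weight_def)
qed

lemma fejer_weight_ge: "N > 0 \<Longrightarrow> 1 - real_of_int \<bar>n\<bar> / real N \<le> fejer_weight N n"
proof -
  assume N: "N > 0"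
  let ?D = "{p \<in> {..<N} \<times> {..<N}. int (fst p) - int (snd p) = n}"
  have "card {..<N - nat \<bar>n\<bar>} \<le> card ?D"
  proof (rule card_inj_on_le)
    show "inj_on (\<lambda>k. if n \<ge> 0 then (k + nat n, k) else (k, k + nat (- n))) {..<N - nat \<bar>n\<bar>}"
      by (auto simp: inj_on_def)
    show "(\<lambda>k. if n \<ge> 0 then (k + nat n, k) else (k, k + nat (- n))) ` {..<N - nat \<bar>n\<bar>} \<subseteq> ?D"
      by auto
    show "finite ?D" by (rule finite_subset[of _ "{..<N} \<times> {..<N}"]) auto
  qed
  then have "real N - real_of_int \<bar>n\<bar> \<le> real (card ?D)" by simp
  then have "(real N - real_of_int \<bar>n\<bar>) / real N \<le> real (card ?D) / real N"
    by (rule divide_right_mono) simp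
  then show ?thesis
    using N by (simp add: fejer_weight_def diff_divide_distrib)
qed

lemma fejer_weight_tendsto: "(\<lambda>N. fejer_weight N n) \<longlonglongrightarrow> 1"
proof (rule tendsto_sandwich)
  show "\<forall>\<^sub>F N in sequentially. 1 - real_of_int \<bar>n\<bar> / real N \<le> fejer_weight N n"
    using eventually_gt_at_top[of 0] by eventually_elim (rule fejer_weight_ge)
  show "(\<lambda>N. 1 - real_of_int \<bar>n\<bar> / real N) \<longlonglongrightarrow> 1"
    using tendsto_diff[OF tendsto_const lim_const_over_n[of "real_of_int \<bar>n\<bar>"], of 1] by simp
qed (auto simp: fejer_weight_le_1)

lemma fejer_mean_eq_double_sum:
  "fejer_mean f N \<theta> =
    (\<Sum>k<N. \<Sum>l<N. f (int k - int l) * cis (of_int (int k - int l) * \<theta>)) / of_nat N"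
proof -
  let ?S = "{..<N} \<times> {..<N}" and ?d = "\<lambda>p::nat \<times> nat. int (fst p) - int (snd p)"
  let ?h = "\<lambda>n. f n * cis (of_int n * \<theta>)"
  have "(\<Sum>k<N. \<Sum>l<N. ?h (int k - int l)) = (\<Sum>p\<in>?S. ?h (?d p))"
    by (simp add: sum.cartesian_product case_prod_beta)
  also have "\<dots> = (\<Sum>n\<in>{- int N..int N}. \<Sum>p\<in>{p \<in> ?S. ?d p = n}. ?h (?d p))"
    by (rule sum.group[symmetric]) auto
  also have "\<dots> = (\<Sum>n\<in>{- int N..int N}. of_nat (card {p \<in> ?S. ?d p = n}) * ?h n)"
    by (intro sum.cong refl) simp
  finally show ?thesis
    by (simp add: fejer_mean_def fejer_weight_def sum_divide_distrib mult_ac)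
qed

text \<open>Up to the factor \<open>1 / N\<close> the Fejer mean at \<open>\<theta>\<close> is the Toeplitz form evaluated at the
  vector \<open>cis (- n \<theta>)\<close>, \<open>n < N\<close>, whose squared norm is \<open>N\<close>.\<close>

lemma fejer_mean_bound:
  assumes "form_bounded (Gamma_nat f) C" and N: "N > 0"
  shows "cmod (fejer_mean f N \<theta>) \<le> 2 * C"
proof -
  let ?e = "\<lambda>n::nat. cis (- (real n * \<theta>))"
  have "(\<Sum>k<N. \<Sum>l<N. f (int k - int l) * cis (of_int (int k - int l) * \<theta>))
      = (\<Sum>k<N. \<Sum>l<N. Gamma_nat f k l * ?e l * cnj (?e k))"
    by (simp add: Gamma_nat_def cis_cnj cis_mult left_diff_distrib mult.assoc)
  then have "cmod (\<Sum>k<N. \<Sum>l<N. f (int k - int l) * cis (of_int (int k - int l) * \<theta>)) \<le> C * (2 * real N)"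
    using form_boundedD[OF assms(1), of "{..<N}" "{..<N}" ?e ?e] by simp
  then show ?thesis
    using N by (simp add: fejer_mean_eq_double_sum norm_divide field_simps)
qed

lemma continuous_fejer_mean: "continuous_on UNIV (fejer_mean f N)"
  unfolding fejer_mean_def by (intro continuous_intros)

lemma fourier_coeff_fejer_mean:
  "(LINT \<theta>|circle_measure. fejer_mean f N \<theta> * cis (- (of_int n * \<theta>)))
    = of_real (2 * pi) * (of_real (fejer_weight N n) * f n)"
proof -
  let ?a = "\<lambda>j. of_real (fejer_weight N j) * f j"
  \<comment> \<open>a trivial inner sum gives the integrand the shape of a double sum\<close>
  have "(LINT \<theta>|circle_measure. fejer_mean f N \<theta> * cis (- (of_int n * \<theta>)))
      = (LINT \<theta>|circle_measure. (\<Sum>j\<in>{- int N..int N}. \<Sum>l\<in>{()}. ?a j * cis (of_int (j - n) * \<theta>)))"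
    by (simp add: fejer_mean_def sum_distrib_right cis_mult left_diff_distrib mult.assoc)
  also have "\<dots> = (\<Sum>j\<in>{- int N..int N}. \<Sum>l\<in>{()}. ?a j * (LINT \<theta>|circle_measure. cis (of_int (j - n) * \<theta>)))"
    by (rule integral_double_sum) (intro continuous_circle_integrable continuous_intros)
  also have "\<dots> = (\<Sum>j\<in>{- int N..int N}. if j = n then of_real (2 * pi) * ?a n else 0)"
    unfolding integral_cis_int by (intro sum.cong refl) auto
  also have "\<dots> = of_real (2 * pi) * ?a n"
    by (simp add: fejer_weight_eq_0)
  finally show ?thesis .
qed

text \<open>Any finite set of coefficients occurs in a row of the matrix that is far enough down, and all
  rows have the same bound.\<close>

lemma form_bounded_toeplitz_l2:
  assumes "form_bounded (Gamma_nat f) C"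
  shows "(\<lambda>n. (cmod (f n))\<^sup>2) summable_on UNIV"
proof -
  obtain D where K: "form_bounded (Gamma_nat f) D" and D: "D > 0"
    using form_bounded_pos[OF assms] by blast
  have "(\<Sum>n\<in>F. (cmod (f n))\<^sup>2) \<le> 4 * D\<^sup>2" if F: "finite F" for F
  proof -
    obtain k :: nat where k: "\<And>n. n \<in> F \<Longrightarrow> n \<le> int k"
      using F by (metis finite_nat_set_iff_bounded_le finite_imageI imageI nat_le_iff)
    have "(\<Sum>l\<in>(\<lambda>n. nat (int k - n)) ` F. (cmod (Gamma_nat f k l))\<^sup>2) = (\<Sum>n\<in>F. (cmod (f n))\<^sup>2)"
      by (subst sum.reindex) (use k in \<open>auto simp: inj_on_def Gamma_nat_def intro!: sum.cong, (metis diff_ge_0_iff_ge eq_nat_nat_iff diff_left_imp_eq | simp)+\<close>)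
    then show ?thesis
      using form_bounded_row[OF K D, of "(\<lambda>n. nat (int k - n)) ` F" k] F by simp
  qed
  then show ?thesis
    by (intro nonneg_bounded_partial_sums_imp_summable_on[of _ _ "4 * D\<^sup>2"])
      (auto intro: eventually_finite_subsets_at_top_weakI)
qed

text \<open>Outside a large finite set the tail of \<open>f\<close> is small, as the weights lie between \<open>0\<close> and
  \<open>1\<close>; on the finite set the weights tend to \<open>1\<close>.\<close>

lemma fejer_mean_l2_approx:
  assumes s: "(\<lambda>n. (cmod (f n))\<^sup>2) summable_on UNIV" and e: "\<epsilon> > 0"
  shows "\<exists>N>0. \<forall>F. finite F \<longrightarrow> (\<Sum>n\<in>F. ((1 - fejer_weight N n) * cmod (f n))\<^sup>2) \<le> \<epsilon>"
proof -
  let ?q = "\<lambda>n. (cmod (f n))\<^sup>2"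
  have "\<forall>\<^sub>F F in finite_subsets_at_top UNIV. dist (sum ?q F) (infsum ?q UNIV) < \<epsilon> / 2"
    using has_sum_infsum[OF s] e unfolding has_sum_def by (intro tendstoD) auto
  then obtain F0 where F0: "finite F0" and d: "dist (sum ?q F0) (infsum ?q UNIV) < \<epsilon> / 2"
    unfolding eventually_finite_subsets_at_top by blast
  have "(\<lambda>N. \<Sum>n\<in>F0. ((1 - fejer_weight N n) * cmod (f n))\<^sup>2) \<longlonglongrightarrow> (\<Sum>n\<in>F0. ((1 - 1) * cmod (f n))\<^sup>2)"
    by (intro tendsto_intros fejer_weight_tendsto)
  then have "(\<lambda>N. \<Sum>n\<in>F0. ((1 - fejer_weight N n) * cmod (f n))\<^sup>2) \<longlonglongrightarrow> 0" by simp
  then have "\<forall>\<^sub>F N in sequentially. (\<Sum>n\<in>F0. ((1 - fejer_weight N n) * cmod (f n))\<^sup>2) < \<epsilon> / 2"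
    using e by (intro order_tendstoD) auto
  then have "\<forall>\<^sub>F N in sequentially. N > 0 \<and> (\<Sum>n\<in>F0. ((1 - fejer_weight N n) * cmod (f n))\<^sup>2) < \<epsilon> / 2"
    using eventually_gt_at_top[of 0] by eventually_elim auto
  then obtain N where N: "N > 0" and small: "(\<Sum>n\<in>F0. ((1 - fejer_weight N n) * cmod (f n))\<^sup>2) < \<epsilon> / 2"
    by (auto simp: eventually_sequentially)
  have w: "0 \<le> fejer_weight N n" for n by (simp add: fejer_weight_def)
  have "(\<Sum>n\<in>F. ((1 - fejer_weight N n) * cmod (f n))\<^sup>2) \<le> \<epsilon>" if F: "finite F" for F
  proof -
    have "(\<Sum>n\<in>F. ((1 - fejer_weight N n) * cmod (f n))\<^sup>2)
        \<le> (\<Sum>n\<in>F0 \<union> (F - F0). ((1 - fejer_weight N n) * cmod (f n))\<^sup>2)"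
      by (rule sum_mono2) (use F F0 in auto)
    also have "\<dots> = (\<Sum>n\<in>F0. ((1 - fejer_weight N n) * cmod (f n))\<^sup>2)
        + (\<Sum>n\<in>F - F0. ((1 - fejer_weight N n) * cmod (f n))\<^sup>2)"
      by (rule sum.union_disjoint) (use F F0 in auto)
    also have "(\<Sum>n\<in>F - F0. ((1 - fejer_weight N n) * cmod (f n))\<^sup>2) \<le> sum ?q (F - F0)"
    proof (rule sum_mono)
      fix n
      show "((1 - fejer_weight N n) * cmod (f n))\<^sup>2 \<le> (cmod (f n))\<^sup>2"
        using w[of n] fejer_weight_le_1[of N n] by (intro power_mono mult_left_le_one_le) auto
    qed
    also have "sum ?q (F - F0) = sum ?q (F0 \<union> F) - sum ?q F0"
      using F F0 by (simp add: Un_Diff flip: sum_diff)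
    also have "\<dots> \<le> infsum ?q UNIV - sum ?q F0"
      using finite_sum_le_infsum[OF s, of "F0 \<union> F"] F F0 by simp
    also have "\<dots> \<le> \<epsilon> / 2" using d unfolding dist_real_def by linarith
    finally show ?thesis using small by linarith
  qed
  with N show ?thesis by blast
qed


lemma fejer_mean_superset:
  assumes "finite I" "{- int N..int N} \<subseteq> I"
  shows "fejer_mean f N \<theta> = (\<Sum>n\<in>I. of_real (fejer_weight N n) * f n * cis (of_int n * \<theta>))"
  unfolding fejer_mean_def
  by (rule sum.mono_neutral_left) (use assms in \<open>auto simp: fejer_weight_eq_0\<close>)

text \<open>Parseval's identity gives \<open>8 \<pi> t\<^sup>2\<close> as a bound for the integral of \<open>|d|\<^sup>2\<close>, where \<open>d\<close> is the
  difference; \<open>|d| \<le> t / 2 + |d|\<^sup>2 / (2 t)\<close> turns this into a bound for the integral of \<open>|d|\<close>.\<close>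

lemma fejer_mean_diff_L1:
  assumes M: "\<And>F. finite F \<Longrightarrow> (\<Sum>n\<in>F. ((1 - fejer_weight M n) * cmod (f n))\<^sup>2) \<le> t\<^sup>2"
    and N: "\<And>F. finite F \<Longrightarrow> (\<Sum>n\<in>F. ((1 - fejer_weight N n) * cmod (f n))\<^sup>2) \<le> t\<^sup>2"
    and t: "t > 0"
  shows "(LINT \<theta>|circle_measure. cmod (fejer_mean f M \<theta> - fejer_mean f N \<theta>)) \<le> 5 * pi * t"
proof -
  define I where "I = {- int (max M N)..int (max M N)}"
  define e where "e n = of_real (fejer_weight M n - fejer_weight N n) * f n" for n
  let ?d = "\<lambda>\<theta>. fejer_mean f M \<theta> - fejer_mean f N \<theta>"
  have I: "finite I" by (simp add: I_def)
  have d: "?d \<theta> = (\<Sum>n\<in>I. e n * cis (of_int n * \<theta>))" for \<theta>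
    using fejer_mean_superset[OF I, of M f \<theta>] fejer_mean_superset[OF I, of N f \<theta>]
    by (simp add: I_def e_def left_diff_distrib sum_subtractf)
  have "(\<Sum>n\<in>I. (cmod (e n))\<^sup>2) \<le> (\<Sum>n\<in>I. 2 * ((1 - fejer_weight M n) * cmod (f n))\<^sup>2 + 2 * ((1 - fejer_weight N n) * cmod (f n))\<^sup>2)"
  proof (rule sum_mono)
    fix n
    have "(fejer_weight M n - fejer_weight N n)\<^sup>2 \<le> 2 * (1 - fejer_weight M n)\<^sup>2 + 2 * (1 - fejer_weight N n)\<^sup>2"
      using norm_add_sq_le[of "fejer_weight M n - 1" "1 - fejer_weight N n"] by (simp add: power2_commute)
    then have "(fejer_weight M n - fejer_weight N n)\<^sup>2 * (cmod (f n))\<^sup>2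
        \<le> (2 * (1 - fejer_weight M n)\<^sup>2 + 2 * (1 - fejer_weight N n)\<^sup>2) * (cmod (f n))\<^sup>2"
      by (rule mult_right_mono) simp
    then show "(cmod (e n))\<^sup>2 \<le> 2 * ((1 - fejer_weight M n) * cmod (f n))\<^sup>2 + 2 * ((1 - fejer_weight N n) * cmod (f n))\<^sup>2"
      unfolding e_def norm_mult norm_of_real power_mult_distrib power2_abs by (simp add: distrib_right)
  qed
  also have "\<dots> \<le> 4 * t\<^sup>2"
    using M[OF I] N[OF I] by (simp add: sum.distrib sum_distrib_left[symmetric])
  finally have e: "(\<Sum>n\<in>I. (cmod (e n))\<^sup>2) \<le> 4 * t\<^sup>2" .
  have sq: "(LINT \<theta>|circle_measure. (cmod (?d \<theta>))\<^sup>2) \<le> 8 * pi * t\<^sup>2"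
    unfolding d using parseval_trig_polynomial[OF I, of "\<lambda>n. n" e] mult_left_mono[OF e, of "2 * pi"]
    by simp
  have i: "integrable circle_measure (\<lambda>\<theta>. cmod (?d \<theta>))" "integrable circle_measure (\<lambda>\<theta>. (cmod (?d \<theta>))\<^sup>2)"
    by (intro continuous_circle_integrable continuous_intros continuous_fejer_mean)+
  have "(LINT \<theta>|circle_measure. cmod (?d \<theta>)) \<le> (LINT \<theta>|circle_measure. t / 2 + 1 / (2 * t) * (cmod (?d \<theta>))\<^sup>2)"
  proof (rule integral_mono)
    show "integrable circle_measure (\<lambda>\<theta>. t / 2 + 1 / (2 * t) * (cmod (?d \<theta>))\<^sup>2)"
      by (intro continuous_circle_integrable continuous_intros continuous_fejer_mean)
    fix \<theta>
    have "2 * t * cmod (?d \<theta>) \<le> t\<^sup>2 + (cmod (?d \<theta>))\<^sup>2"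
      by (rule sum_squares_bound)
    then show "cmod (?d \<theta>) \<le> t / 2 + 1 / (2 * t) * (cmod (?d \<theta>))\<^sup>2"
      using t by (simp add: field_simps power2_eq_square)
  qed (rule i)
  also have "\<dots> = t / 2 * (2 * pi) + 1 / (2 * t) * (LINT \<theta>|circle_measure. (cmod (?d \<theta>))\<^sup>2)"
    by (subst Bochner_Integration.integral_add)
      (use i(2) in \<open>auto simp: measure_restrict_space intro!: finite_measure.integrable_const finite_measure_circle\<close>)
  also have "\<dots> \<le> t / 2 * (2 * pi) + 1 / (2 * t) * (8 * pi * t\<^sup>2)"
    by (intro add_left_mono mult_left_mono sq) (use t in auto)
  also have "\<dots> = 5 * pi * t"
    using t by (simp add: field_simps power2_eq_square)
  finally show ?thesis .
qed

text \<open>By monotone convergence the sum of the absolute steps has a finite integral, hence is finite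
  almost everywhere, and then the telescoping series converges.\<close>

lemma AE_convergent_of_summable_L1_steps:
  fixes u :: "nat \<Rightarrow> 'a \<Rightarrow> complex"
  assumes u: "\<And>j. integrable M (u j)"
    and s: "summable (\<lambda>j. LINT x|M. cmod (u (Suc j) x - u j x))"
  shows "AE x in M. convergent (\<lambda>j. u j x)"
proof -
  let ?d = "\<lambda>j x. cmod (u (Suc j) x - u j x)"
  have d: "integrable M (?d j)" for j
    by (intro integrable_norm Bochner_Integration.integrable_diff u)
  have "(\<integral>\<^sup>+x. (\<Sum>j. ennreal (?d j x)) \<partial>M) = (\<Sum>j. \<integral>\<^sup>+x. ennreal (?d j x) \<partial>M)"
    by (rule nn_integral_suminf) (use d in measurable)
  also have "\<dots> = (\<Sum>j. ennreal (LINT x|M. ?d j x))"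
    by (intro suminf_cong nn_integral_eq_integral d) auto
  also have "\<dots> \<noteq> \<infinity>"
    using s by (simp add: suminf_ennreal_eq suminf_ennreal2)
  finally have "AE x in M. (\<Sum>j. ennreal (?d j x)) \<noteq> \<infinity>"
    by (intro nn_integral_noteq_infinite) (use d in measurable)
  then show ?thesis
  proof eventually_elim
    case (elim x)
    then have "summable (\<lambda>j. ?d j x)"
      by (intro summable_suminf_not_top) auto
    then have "summable (\<lambda>j. u (Suc j) x - u j x)"
      by (rule summable_norm_cancel)
    then have "convergent (\<lambda>n. (\<Sum>j<n. u (Suc j) x - u j x))"
      by (simp add: summable_iff_convergent)
    then have "convergent (\<lambda>n. (u n x - u 0 x) + u 0 x)"
      unfolding sum_lessThan_telescope[of "\<lambda>j. u j x"] by (intro convergent_add convergent_const)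
    then show ?case by simp
  qed
qed

text \<open>The symbol is the limit of a subsequence of Fejer means, set to \<open>0\<close> wherever the limit does
  not obey the bound that holds for the means.  This makes it bounded and periodic everywhere,
  although convergence is only known almost everywhere on one period.\<close>

lemma form_bounded_imp_Linf_series:
  assumes K: "form_bounded (Gamma_nat f) C"
  shows "f \<in> Linf_series"
proof -
  \<comment> \<open>the rate \<open>2\<^sup>-\<^sup>j\<close> makes the \<open>L\<^sup>1\<close> distances of successive means summable\<close>
  have "\<exists>N>0. \<forall>F. finite F \<longrightarrow> (\<Sum>n\<in>F. ((1 - fejer_weight N n) * cmod (f n))\<^sup>2) \<le> ((1/2) ^ j)\<^sup>2" for j :: nat
    by (rule fejer_mean_l2_approx[OF form_bounded_toeplitz_l2[OF K]]) simp
  then obtain N where N: "\<And>j. N j > 0"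
    and app: "\<And>j F. finite F \<Longrightarrow> (\<Sum>n\<in>F. ((1 - fejer_weight (N j) n) * cmod (f n))\<^sup>2) \<le> ((1/2) ^ j)\<^sup>2"
    by metis
  define u where "u j = fejer_mean f (N j)" for j
  define g where "g \<theta> = (if cmod (lim (\<lambda>j. u j \<theta>)) \<le> 2 * C then lim (\<lambda>j. u j \<theta>) else 0)" for \<theta>
  have uB: "cmod (u j \<theta>) \<le> 2 * C" for j \<theta>
    unfolding u_def by (rule fejer_mean_bound[OF K N])
  have C: "0 \<le> 2 * C" using order_trans[OF norm_ge_zero uB] .
  have um: "u j \<in> borel_measurable lebesgue" for j
    unfolding u_def by (rule continuous_circle_measurable[OF continuous_fejer_mean])
  have ui: "integrable circle_measure (u j)" for j
    unfolding u_def by (rule continuous_circle_integrable[OF continuous_fejer_mean])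
  have limm: "(\<lambda>\<theta>. lim (\<lambda>j. u j \<theta>)) \<in> borel_measurable lebesgue"
    by (rule borel_measurable_lim_metric) (rule um)
  have gm: "g \<in> borel_measurable lebesgue"
    unfolding g_def using limm by measurable
  have per: "u j (\<theta> + 2 * pi) = u j \<theta>" for j \<theta>
  proof -
    have "cis (of_int n * (\<theta> + 2 * pi)) = cis (of_int n * \<theta>)" for n
      using cis_multiple_2pi[of "of_int n"] by (simp add: distrib_left cis_mult[symmetric] mult_ac)
    then show ?thesis by (simp add: u_def fejer_mean_def)
  qed
  have "g \<in> Linf_circle"
    unfolding Linf_circle_def
  proof (intro CollectI conjI exI allI gm AE_I2)
    show "g (\<theta> + 2 * pi) = g \<theta>" for \<theta> by (simp add: g_def per)
    show "cmod (g \<theta>) \<le> 2 * C" for \<theta> using C by (simp add: g_def)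
  qed
  moreover have "fourier_coeff g = f"
  proof
    fix n
    have "summable (\<lambda>j. 5 * pi * (1/2::real) ^ j)" by (intro summable_mult summable_geometric) simp
    moreover have "norm (LINT \<theta>|circle_measure. cmod (u (Suc j) \<theta> - u j \<theta>)) \<le> 5 * pi * (1/2) ^ j" for j
    proof -
      have "(\<Sum>n\<in>F. ((1 - fejer_weight (N (Suc j)) n) * cmod (f n))\<^sup>2) \<le> ((1/2) ^ j)\<^sup>2" if "finite F" for F
        using app[OF that, of "Suc j"] by (rule order_trans) (intro power_mono power_decreasing; simp)
      then show ?thesis
        unfolding u_def using fejer_mean_diff_L1[of "N (Suc j)" f "(1/2) ^ j" "N j"] app[of _ j]
        by (simp add: integral_nonneg_AE)
    qed
    ultimately have "summable (\<lambda>j. LINT \<theta>|circle_measure. cmod (u (Suc j) \<theta> - u j \<theta>))"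
      by (rule summable_comparison_test'[where N = 0])
    then have "AE \<theta> in circle_measure. convergent (\<lambda>j. u j \<theta>)"
      by (rule AE_convergent_of_summable_L1_steps[OF ui])
    then have lim: "AE \<theta> in circle_measure. (\<lambda>j. u j \<theta>) \<longlonglongrightarrow> g \<theta>"
    proof eventually_elim
      case (elim \<theta>)
      then have l: "(\<lambda>j. u j \<theta>) \<longlonglongrightarrow> lim (\<lambda>j. u j \<theta>)" by (simp add: convergent_LIMSEQ_iff)
      have "cmod (lim (\<lambda>j. u j \<theta>)) \<le> 2 * C"
        by (rule Lim_norm_ubound[OF _ l]) (auto simp: uB)
      with l show ?case by (simp add: g_def)
    qed
    let ?e = "\<lambda>\<theta>. cis (- (of_int n * \<theta>))"
    have em: "?e \<in> borel_measurable lebesgue"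
      by (intro continuous_circle_measurable continuous_intros)
    have "(\<lambda>j. LINT \<theta>|circle_measure. u j \<theta> * ?e \<theta>) \<longlonglongrightarrow> (LINT \<theta>|circle_measure. g \<theta> * ?e \<theta>)"
    proof (rule integral_dominated_convergence[where w = "\<lambda>_. 2 * C"])
      show "(\<lambda>\<theta>. g \<theta> * ?e \<theta>) \<in> borel_measurable circle_measure"
        by (intro circle_measurable borel_measurable_times gm em)
      show "(\<lambda>\<theta>. u j \<theta> * ?e \<theta>) \<in> borel_measurable circle_measure" for j
        by (intro circle_measurable borel_measurable_times um em)
      show "AE \<theta> in circle_measure. (\<lambda>j. u j \<theta> * ?e \<theta>) \<longlonglongrightarrow> g \<theta> * ?e \<theta>"
        using lim by eventually_elim (intro tendsto_intros)
      show "AE \<theta> in circle_measure. cmod (u j \<theta> * ?e \<theta>) \<le> 2 * C" for j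
        by (simp add: norm_mult uB)
    qed (intro finite_measure.integrable_const finite_measure_circle)
    moreover have "(\<lambda>j. LINT \<theta>|circle_measure. u j \<theta> * ?e \<theta>) \<longlonglongrightarrow> of_real (2 * pi) * f n"
    proof -
      have "(\<lambda>j. cmod (of_real (fejer_weight (N j) n) * f n - f n)) \<longlonglongrightarrow> 0"
      proof (rule tendsto_sandwich[of "\<lambda>_. 0"])
        show "(\<lambda>j. (1/2::real) ^ j) \<longlonglongrightarrow> 0" by (rule LIMSEQ_power_zero) simp
        show "\<forall>\<^sub>F j in sequentially. cmod (of_real (fejer_weight (N j) n) * f n - f n) \<le> (1/2) ^ j"
        proof (rule always_eventually, rule allI)
          fix j
          have "of_real (fejer_weight (N j) n) * f n - f n = of_real (fejer_weight (N j) n - 1) * f n"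
            by (simp add: left_diff_distrib)
          then have "(cmod (of_real (fejer_weight (N j) n) * f n - f n))\<^sup>2 \<le> ((1/2) ^ j)\<^sup>2"
            using app[of "{n}" j]
            by (simp only: norm_mult norm_of_real power_mult_distrib power2_abs)
              (simp add: power_mult_distrib power2_commute)
          then show "cmod (of_real (fejer_weight (N j) n) * f n - f n) \<le> (1/2) ^ j"
            by (rule power2_le_imp_le) simp
        qed
      qed auto
      then have "(\<lambda>j. of_real (fejer_weight (N j) n) * f n) \<longlonglongrightarrow> f n"
        by (simp add: LIM_zero_iff tendsto_norm_zero_iff)
      then show ?thesis
        unfolding u_def fourier_coeff_fejer_mean by (intro tendsto_intros)
    qed
    ultimately show "fourier_coeff g n = f n"
      using LIMSEQ_unique by (fastforce simp: fourier_coeff_circle)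
  qed
  ultimately show ?thesis unfolding Linf_series_def by blast
qed

section \<open>Tensor powers of a unitary matrix\<close>

lemma finite_words [simp]: "finite {w :: 'q::finite list. length w = n}"
  using finite_lists_length_eq[of "UNIV :: 'q set" n] by simp

lemma sum_words_Suc:
  "(\<Sum>w | length w = Suc n. g w) = (\<Sum>i\<in>UNIV. \<Sum>w | length w = n. g (i # w))"
  for g :: "'q::finite list \<Rightarrow> 'a::comm_monoid_add"
proof -
  have "{w :: 'q list. length w = Suc n} = (\<lambda>(i, w). i # w) ` (UNIV \<times> {w. length w = n})"
    by (auto simp: length_Suc_conv image_iff)
  moreover have "inj_on (\<lambda>(i, w). i # w) (UNIV \<times> {w :: 'q list. length w = n})"
    by (auto simp: inj_on_def)
  ultimately show ?thesis
    by (simp only: sum.reindex sum.cartesian_product) (simp add: case_prod_beta comp_def)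
qed

lemma sum_words_add:
  "(\<Sum>w | length w = m + n. g w) = (\<Sum>w1 | length w1 = m. \<Sum>w2 | length w2 = n. g (w1 @ w2))"
  for g :: "'q::finite list \<Rightarrow> 'a::comm_monoid_add"
  by (induction m arbitrary: g) (simp_all add: sum_words_Suc)

lemma word_eval_simps [simp]:
  "word_eval [] a = 1" "word_eval (i # w) a = a $ i * word_eval w a"
  by (simp_all add: word_eval_def)

text \<open>The entry of the tensor power \<open>M \<otimes> \<dots> \<otimes> M\<close> at two words of equal length, and \<open>0\<close> otherwise:
  the matrix of the operator that \<open>M\<close> induces on the Fock space over \<open>\<complex>\<^sup>q\<close>.\<close>

fun tensor_entry :: "complex ^ 'q ^ 'q \<Rightarrow> 'q list \<Rightarrow> 'q list \<Rightarrow> complex"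
  where
    "tensor_entry M [] [] = 1"
  | "tensor_entry M (i # u) (j # v) = M $ i $ j * tensor_entry M u v"
  | "tensor_entry M _ _ = 0"

lemma tensor_entry_append:
  "length u1 = length v1 \<Longrightarrow>
    tensor_entry M (u1 @ u2) (v1 @ v2) = tensor_entry M u1 v1 * tensor_entry M u2 v2"
  by (induction u1 v1 rule: list_induct2) simp_all

text \<open>Functoriality of the tensor power; with \<open>tensor_entry_1\<close> and \<open>tensor_entry_adjoint\<close> it
  transfers unitarity from \<open>M\<close> to its tensor powers.\<close>

lemma tensor_entry_mult:
  fixes M N :: "complex ^ 'q::finite ^ 'q"
  assumes "length u = length v"
  shows "(\<Sum>w | length w = length u. tensor_entry M u w * tensor_entry N w v) = tensor_entry (M ** N) u v"
  using assms
proof (induction u v rule: list_induct2)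
  case (Cons i u j v)
  have "(\<Sum>w | length w = length (i # u). tensor_entry M (i # u) w * tensor_entry N w (j # v))
      = (\<Sum>k\<in>UNIV. \<Sum>w | length w = length u. (M $ i $ k * N $ k $ j) * (tensor_entry M u w * tensor_entry N w v))"
    by (simp add: sum_words_Suc mult_ac)
  also have "\<dots> = tensor_entry (M ** N) (i # u) (j # v)"
    by (simp add: Cons.IH matrix_matrix_mult_def flip: sum_distrib_left sum_distrib_right)
  finally show ?case .
qed simp

lemma tensor_entry_1:
  "length u = length v \<Longrightarrow> tensor_entry (mat 1) u v = (if u = v then 1 else 0)"
  by (induction u v rule: list_induct2) (auto simp: mat_def)

lemma tensor_entry_length: "length u \<noteq> length v \<Longrightarrow> tensor_entry M u v = 0"
  by (induction M u v rule: tensor_entry.induct) auto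

text \<open>\<open>u \<mapsto> word_eval u b\<close> on words of length \<open>n\<close> is the tensor power of the vector \<open>b\<close>.\<close>

lemma word_eval_matrix_vector:
  fixes M :: "complex ^ 'q::finite ^ 'q"
  shows "word_eval u (M *v b) = (\<Sum>w | length w = length u. tensor_entry M u w * word_eval w b)"
proof (induction u)
  case (Cons i u)
  have "(\<Sum>w | length w = length (i # u). tensor_entry M (i # u) w * word_eval w b)
      = (\<Sum>k\<in>UNIV. \<Sum>w | length w = length u. (M $ i $ k * b $ k) * (tensor_entry M u w * word_eval w b))"
    by (simp add: sum_words_Suc mult_ac)
  also have "\<dots> = (\<Sum>k\<in>UNIV. M $ i $ k * b $ k) * (\<Sum>w | length w = length u. tensor_entry M u w * word_eval w b)"
    by (simp add: sum_product)
  also have "\<dots> = word_eval (i # u) (M *v b)"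
    unfolding Cons.IH[symmetric] by (simp add: matrix_vector_mult_def)
  finally show ?case by simp
qed simp

definition matrix_adjoint :: "complex ^ 'q ^ 'q \<Rightarrow> complex ^ 'q ^ 'q"
  where "matrix_adjoint M = (\<chi> i j. cnj (M $ j $ i))"

lemma matrix_adjoint_adjoint [simp]: "matrix_adjoint (matrix_adjoint M) = M"
  by (simp add: matrix_adjoint_def vec_eq_iff)

lemma tensor_entry_adjoint: "tensor_entry (matrix_adjoint M) u v = cnj (tensor_entry M v u)"
  by (induction M v u rule: tensor_entry.induct) (simp_all add: matrix_adjoint_def)

text \<open>A Householder construction.  Let \<open>\<omega>\<close> be the phase of \<open>a\<^sub>k\<close>, so that \<open>a' = \<omega>\<^sup>* a\<close> has the real
  inner product \<open>r \<ge> 0\<close> with \<open>e\<^sub>k\<close>.  For \<open>v = a' + e\<^sub>k\<close>, which is nonzero, the reflection that fixes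
  \<open>v\<close> and negates its orthogonal complement exchanges \<open>e\<^sub>k\<close> and \<open>a'\<close>; multiply it by \<open>\<omega>\<close>.\<close>

lemma exists_unitary_matrix_to:
  fixes a :: "complex ^ 'q::finite"
  assumes a: "a \<in> unit_sphere"
  shows "\<exists>M. M ** matrix_adjoint M = mat 1 \<and> M *v axis k 1 = a"
proof -
  define \<omega> where "\<omega> = (if a $ k = 0 then 1 else sgn (a $ k))"
  define r where "r = cmod (a $ k)"
  define v where "v = (\<chi> i. cnj \<omega> * a $ i + axis k 1 $ i)"
  define M where "M = (\<chi> i j. \<omega> * (v $ i * cnj (v $ j) / of_real (1 + r) - (if i = j then 1 else 0)))"
  have r: "0 \<le> r" by (simp add: r_def)
  then have r1: "complex_of_real (1 + r) \<noteq> 0" by (simp only: of_real_eq_0_iff)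
  have \<omega>: "\<omega> * cnj \<omega> = 1"
    by (auto simp: \<omega>_def complex_norm_square[symmetric] norm_sgn)
  have ak: "cnj \<omega> * a $ k = of_real r"
  proof (cases "a $ k = 0")
    case False
    then have "cnj (sgn (a $ k)) * a $ k = of_real (cmod (a $ k))"
      by (simp add: sgn_eq complex_norm_square[symmetric] power2_eq_square mult.commute[of _ "a $ k"])
    then show ?thesis using False by (simp add: \<omega>_def r_def)
  qed (simp add: r_def)
  have vk: "v $ k = of_real (1 + r)"
    by (simp add: v_def ak axis_def)
  \<comment> \<open>\<open>|v|\<^sup>2 = |a'|\<^sup>2 + 2 r + 1\<close>\<close>
  have "(\<Sum>i\<in>UNIV. v $ i * cnj (v $ i))
      = (\<Sum>i\<in>UNIV. (\<omega> * cnj \<omega>) * of_real ((cmod (a $ i))\<^sup>2)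
          + (if i = k then cnj \<omega> * a $ i + cnj (cnj \<omega> * a $ i) + 1 else 0))"
    by (intro sum.cong refl) (auto simp: v_def axis_def complex_norm_square algebra_simps simp del: of_real_power)
  also have "\<dots> = of_real (2 * (1 + r))"
    using a by (simp add: sum.distrib \<omega> ak unit_sphere_def flip: of_real_sum of_real_power)
  finally have vv: "(\<Sum>i\<in>UNIV. v $ i * cnj (v $ i)) = of_real (2 * (1 + r))" .
  have "(M ** matrix_adjoint M) $ i $ j = mat 1 $ i $ j" for i j
  proof -
    define s where "s = complex_of_real (1 + r)"
    have s: "s \<noteq> 0" "cnj s = s" using r1 by (simp_all add: s_def)
    let ?d = "\<lambda>i j. if i = j then 1 else 0 :: complex"
    have "(M ** matrix_adjoint M) $ i $ j
        = (\<Sum>l\<in>UNIV. (\<omega> * cnj \<omega>) * ((v $ i * cnj (v $ l) / s - ?d i l) * (cnj (v $ j) * v $ l / s - ?d j l)))"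
      unfolding matrix_matrix_mult_def matrix_adjoint_def M_def s_def[symmetric]
      by (auto simp: s intro!: sum.cong)
    also have "\<dots> = (\<Sum>l\<in>UNIV. v $ i * cnj (v $ j) / s\<^sup>2 * (v $ l * cnj (v $ l))
        - (if l = j then v $ i * cnj (v $ l) / s else 0) - (if l = i then cnj (v $ j) * v $ l / s else 0)
        + (if l = i then ?d i j else 0))"
      unfolding \<omega> by (intro sum.cong refl) (use s in \<open>auto simp: field_simps power2_eq_square\<close>)
    also have "\<dots> = v $ i * cnj (v $ j) / s\<^sup>2 * (2 * s) - v $ i * cnj (v $ j) / s - cnj (v $ j) * v $ i / s + ?d i j"
      unfolding sum.distrib sum_subtractf sum_distrib_left[symmetric] vv s_def by simp
    also have "\<dots> = ?d i j"
      using s by (simp add: field_simps power2_eq_square)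
    finally show ?thesis by (simp add: mat_def)
  qed
  moreover have "(M *v axis k 1) $ i = a $ i" for i
  proof -
    have "(M *v axis k 1) $ i = M $ i $ k"
      by (simp add: matrix_vector_mult_def axis_def if_distrib cong: if_cong)
    also have "\<dots> = \<omega> * (v $ i - (if i = k then 1 else 0))"
      using r1 by (simp add: M_def vk)
    also have "\<dots> = (\<omega> * cnj \<omega>) * a $ i"
      by (simp add: v_def axis_def algebra_simps)
    finally show ?thesis by (simp add: \<omega>)
  qed
  ultimately show ?thesis by (auto simp: vec_eq_iff)
qed

definition word_op :: "complex ^ 'q ^ 'q \<Rightarrow> 'q::finite list ell2 \<Rightarrow> 'q list ell2"
  where "word_op M \<phi> = Abs_l2sum (\<lambda>u. \<Sum>v | length v = length u. tensor_entry M u v * coord \<phi> v)"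

lemma tensor_isometry_level:
  fixes c :: "'q::finite list \<Rightarrow> complex"
  assumes M: "matrix_adjoint M ** M = mat 1"
  shows "(\<Sum>u | length u = n. (cmod (\<Sum>v | length v = n. tensor_entry M u v * c v))\<^sup>2)
    = (\<Sum>v | length v = n. (cmod (c v))\<^sup>2)"
proof -
  let ?W = "{w :: 'q list. length w = n}"
  have "complex_of_real (\<Sum>u\<in>?W. (cmod (\<Sum>v\<in>?W. tensor_entry M u v * c v))\<^sup>2)
      = (\<Sum>u\<in>?W. \<Sum>v\<in>?W. \<Sum>w\<in>?W. cnj (c w) * c v * (tensor_entry (matrix_adjoint M) w u * tensor_entry M u v))"
    unfolding of_real_sum complex_norm_square cnj_sum sum_product tensor_entry_adjoint
    by (intro sum.cong refl) (simp add: mult_ac)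
  also have "\<dots> = (\<Sum>v\<in>?W. \<Sum>w\<in>?W. \<Sum>u\<in>?W. cnj (c w) * c v * (tensor_entry (matrix_adjoint M) w u * tensor_entry M u v))"
    by (subst sum.swap) (intro sum.cong refl sum.swap)
  also have "\<dots> = (\<Sum>v\<in>?W. \<Sum>w\<in>?W. if w = v then cnj (c w) * c v else 0)"
  proof (intro sum.cong refl)
    fix v w assume "v \<in> ?W" "w \<in> ?W"
    then have "(\<Sum>u\<in>?W. tensor_entry (matrix_adjoint M) w u * tensor_entry M u v) = (if w = v then 1 else 0)"
      using tensor_entry_mult[of w v "matrix_adjoint M" M] by (simp add: M tensor_entry_1)
    then show "(\<Sum>u\<in>?W. cnj (c w) * c v * (tensor_entry (matrix_adjoint M) w u * tensor_entry M u v))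
        = (if w = v then cnj (c w) * c v else 0)"
      by (simp flip: sum_distrib_left)
  qed
  also have "\<dots> = complex_of_real (\<Sum>v\<in>?W. (cmod (c v))\<^sup>2)"
    by (simp add: complex_norm_square mult.commute del: of_real_power)
  finally show ?thesis by (simp only: of_real_eq_iff)
qed

text \<open>A finite set of words is contained in the set of all words whose lengths occur in it, and on
  each length the tensor power is isometric.\<close>

lemma tensor_contraction:
  fixes \<phi> :: "'q::finite list ell2"
  assumes M: "matrix_adjoint M ** M = mat 1" and F: "finite F"
  shows "(\<Sum>u\<in>F. (cmod (\<Sum>v | length v = length u. tensor_entry M u v * coord \<phi> v))\<^sup>2) \<le> (norm \<phi>)\<^sup>2"
proof -
  define L where "L = length ` F"
  have L: "finite L" by (simp add: L_def F)
  let ?t = "\<lambda>u. (cmod (\<Sum>v | length v = length u. tensor_entry M u v * coord \<phi> v))\<^sup>2"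
  let ?Y = "{u :: 'q list. length u \<in> L}"
  have Y: "?Y = (\<Union>n\<in>L. {u. length u = n})" by auto
  have fY: "finite ?Y" unfolding Y using L by simp
  have split: "(\<Sum>u\<in>?Y. h u) = (\<Sum>n\<in>L. \<Sum>u | length u = n. h u)" for h :: "'q list \<Rightarrow> real"
    unfolding Y by (rule sum.UNION_disjoint) (use L in auto)
  have "(\<Sum>u\<in>F. ?t u) \<le> (\<Sum>u\<in>?Y. ?t u)"
    by (rule sum_mono2[OF fY]) (auto simp: L_def)
  also have "\<dots> = (\<Sum>n\<in>L. \<Sum>u | length u = n. (cmod (\<Sum>v | length v = n. tensor_entry M u v * coord \<phi> v))\<^sup>2)"
    unfolding split by simp
  also have "\<dots> = (\<Sum>v\<in>?Y. (cmod (coord \<phi> v))\<^sup>2)"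
    unfolding split by (simp only: tensor_isometry_level[OF M])
  also have "\<dots> \<le> (norm \<phi>)\<^sup>2"
    by (rule sum_norm_sq_le_norm_sq[OF fY])
  finally show ?thesis .
qed

lemma coord_word_op:
  assumes "matrix_adjoint M ** M = mat 1"
  shows "coord (word_op M \<phi>) u = (\<Sum>v | length v = length u. tensor_entry M u v * coord \<phi> v)"
  unfolding word_op_def by (subst Abs_l2sum_coord[OF tensor_contraction[OF assms]]) simp_all

lemma word_op_word_op:
  fixes \<phi> :: "'q::finite list ell2"
  assumes M: "matrix_adjoint M ** M = mat 1" and N: "matrix_adjoint N ** N = mat 1" and MN: "M ** N = mat 1"
  shows "word_op M (word_op N \<phi>) = \<phi>"
proof (rule l2sum_eqI)
  fix u :: "'q list"
  let ?W = "{v. length v = length u}"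
  have "coord (word_op M (word_op N \<phi>)) u
      = (\<Sum>v\<in>?W. \<Sum>w\<in>?W. coord \<phi> w * (tensor_entry M u v * tensor_entry N v w))"
    by (auto simp: coord_word_op[OF M] coord_word_op[OF N] sum_distrib_left mult_ac intro!: sum.cong)
  also have "\<dots> = (\<Sum>w\<in>?W. coord \<phi> w * tensor_entry (M ** N) u w)"
    by (subst sum.swap) (auto simp: tensor_entry_mult simp flip: sum_distrib_left intro!: sum.cong)
  also have "\<dots> = (\<Sum>w\<in>?W. if w = u then coord \<phi> w else 0)"
    unfolding MN by (intro sum.cong refl) (auto simp: tensor_entry_1)
  finally show "coord (word_op M (word_op N \<phi>)) u = coord \<phi> u" by simp
qed

text \<open>\<open>word_op M\<close> and \<open>word_op (matrix_adjoint M)\<close> are contractions inverse to each other, hence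
  isometries.\<close>

lemma unitary_word_op:
  fixes M :: "complex ^ 'q::finite ^ 'q"
  assumes M: "M ** matrix_adjoint M = mat 1"
  shows "unitary (word_op M)" "inv (word_op M) = word_op (matrix_adjoint M)"
proof -
  have M': "matrix_adjoint M ** M = mat 1"
    using M matrix_left_right_inverse by blast
  let ?N = "matrix_adjoint M"
  have N: "matrix_adjoint ?N ** ?N = mat 1" using M by simp
  have le: "norm (word_op M \<phi>) \<le> norm \<phi>" if "matrix_adjoint M ** M = mat 1" for M and \<phi> :: "'q list ell2"
    by (rule power2_le_imp_le[OF norm_l2sum_sq_le])
      (simp_all add: coord_word_op[OF that] tensor_contraction[OF that])
  have inv1: "word_op M (word_op ?N \<phi>) = \<phi>" for \<phi> by (rule word_op_word_op[OF M' N M])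
  have inv2: "word_op ?N (word_op M \<phi>) = \<phi>" for \<phi> by (rule word_op_word_op[OF N M' M'])
  show "unitary (word_op M)"
  proof (rule unitaryI)
    show "norm (word_op M \<phi>) = norm \<phi>" for \<phi>
      using le[OF M', of \<phi>] le[OF N, of "word_op M \<phi>"] by (simp add: inv2)
    show "surj (word_op M)" by (rule surjI[of _ "word_op ?N"]) (rule inv1)
  qed (rule l2sum_eqI, simp add: coord_word_op[OF M'] sum.distrib distrib_left sum_distrib_left
      scaleC_complex_def mult_ac)+
  show "inv (word_op M) = word_op ?N"
    by (rule inv_equality) (auto simp: inv1 inv2)
qed

lemma Gamma_word_append: "Gamma_word a f (w @ v) v = f (int (length w)) * word_eval w a"
  by (auto simp: Gamma_word_def)

text \<open>The symmetry of the kernel under taking adjoints; it reduces every computation to pairs whose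
  first word is at least as long as the second.\<close>

lemma Gamma_word_cnj: "Gamma_word a f u v = cnj (Gamma_word a (\<lambda>n. cnj (f (- n))) v u)"
proof -
  consider w where "u = w @ v" | w where "v = w @ u" | "\<nexists>w. u = w @ v" "\<nexists>w. v = w @ u"
    by blast
  then show ?thesis
  proof cases
    case 1
    then show ?thesis
      by (cases "w = []") (auto simp: Gamma_word_def)
  next
    case 2
    then show ?thesis
      by (cases "w = []") (auto simp: Gamma_word_def)
  next
    case 3
    then show ?thesis by (simp add: Gamma_word_def)
  qed
qed

lemma Gamma_word_split:
  assumes "length u2 = length v"
  shows "Gamma_word a f (u1 @ u2) v = (if u2 = v then f (int (length u1)) * word_eval u1 a else 0)"
proof (cases "u2 = v")
  case False
  then have "\<nexists>w. u1 @ u2 = w @ v" "\<nexists>w. v = w @ u1 @ u2"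
    using assms by auto
  then show ?thesis using False by (simp add: Gamma_word_def)
qed (simp add: Gamma_word_append)

text \<open>Tensor powers of \<open>M\<close> intertwine the kernels of \<open>b\<close> and \<open>M b\<close>.  If \<open>u = u1 @ u2\<close> with \<open>u2\<close> as
  long as \<open>v\<close>, the kernel of \<open>b\<close> forces \<open>x\<close> to end in \<open>y\<close>.  The sum then factors: the prefixes
  give the tensor power of \<open>M b\<close> at \<open>u1\<close>, and by unitarity of \<open>M\<close> the suffixes give \<open>1\<close> if
  \<open>u2 = v\<close> and \<open>0\<close> otherwise.\<close>

lemma Gamma_word_matrix_vector:
  fixes M :: "complex ^ 'q::finite ^ 'q"
  assumes M: "M ** matrix_adjoint M = mat 1"
  shows "(\<Sum>x | length x = length u. \<Sum>y | length y = length v.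
      tensor_entry M u x * Gamma_word b f x y * cnj (tensor_entry M v y)) = Gamma_word (M *v b) f u v"
proof -
  have longer: "(\<Sum>x | length x = length u. \<Sum>y | length y = length v.
      tensor_entry M u x * Gamma_word b f x y * cnj (tensor_entry M v y)) = Gamma_word (M *v b) f u v"
    if "length v \<le> length u" for u v :: "'q list" and f
  proof -
    define u1 u2 where "u1 = take (length u - length v) u" and "u2 = drop (length u - length v) u"
    then have u: "u = u1 @ u2" and l: "length u2 = length v"
      using that by simp_all
    let ?V = "{y :: 'q list. length y = length v}"
    have "(\<Sum>x | length x = length u. \<Sum>y\<in>?V. tensor_entry M u x * Gamma_word b f x y * cnj (tensor_entry M v y))
        = (\<Sum>x1 | length x1 = length u1. \<Sum>x2\<in>?V. \<Sum>y\<in>?V.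
            tensor_entry M u (x1 @ x2) * Gamma_word b f (x1 @ x2) y * cnj (tensor_entry M v y))"
      by (simp add: u l sum_words_add)
    also have "\<dots> = (\<Sum>x1 | length x1 = length u1. \<Sum>x2\<in>?V. \<Sum>y\<in>?V.
        if y = x2 then f (int (length u1)) * ((tensor_entry M u1 x1 * word_eval x1 b) *
          (tensor_entry M u2 x2 * tensor_entry (matrix_adjoint M) x2 v)) else 0)"
      by (intro sum.cong refl) (auto simp: u l Gamma_word_split tensor_entry_append tensor_entry_adjoint)
    also have "\<dots> = (\<Sum>x1 | length x1 = length u1. \<Sum>x2\<in>?V. f (int (length u1)) * ((tensor_entry M u1 x1 * word_eval x1 b) *
        (tensor_entry M u2 x2 * tensor_entry (matrix_adjoint M) x2 v)))"
      by simp
    also have "\<dots> = f (int (length u1)) * ((\<Sum>x1 | length x1 = length u1. tensor_entry M u1 x1 * word_eval x1 b) *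
        (\<Sum>x2\<in>?V. tensor_entry M u2 x2 * tensor_entry (matrix_adjoint M) x2 v))"
      by (subst sum_product) (simp only: sum_distrib_left)
    also have "(\<Sum>x1 | length x1 = length u1. tensor_entry M u1 x1 * word_eval x1 b) = word_eval u1 (M *v b)"
      by (rule word_eval_matrix_vector[symmetric])
    also have "(\<Sum>x2\<in>?V. tensor_entry M u2 x2 * tensor_entry (matrix_adjoint M) x2 v) = (if u2 = v then 1 else 0)"
      using tensor_entry_mult[OF l, of M "matrix_adjoint M"] by (simp add: l M tensor_entry_1)
    finally show ?thesis by (simp add: u l Gamma_word_split)
  qed
  show ?thesis
  proof (cases "length v \<le> length u")
    case False
    let ?f = "\<lambda>n. cnj (f (- n))"
    have "Gamma_word (M *v b) f u v = cnj (Gamma_word (M *v b) ?f v u)"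
      by (rule Gamma_word_cnj)
    also have "\<dots> = (\<Sum>y | length y = length v. \<Sum>x | length x = length u.
        cnj (tensor_entry M v y) * cnj (Gamma_word b ?f y x) * tensor_entry M u x)"
      using False by (subst longer[symmetric]) (simp_all add: cnj_sum)
    also have "\<dots> = (\<Sum>x | length x = length u. \<Sum>y | length y = length v.
        cnj (tensor_entry M v y) * cnj (Gamma_word b ?f y x) * tensor_entry M u x)"
      by (rule sum.swap)
    finally show ?thesis
      by (simp only: Gamma_word_cnj[of b f, symmetric] mult_ac)
  qed (rule longer)
qed

text \<open>The matrix identity \<open>Gamma_word_matrix_vector\<close> in terms of operators.  All sums are finite, since
  \<open>word_op M\<close> preserves the length of words.\<close>

lemma kernel_of_word_op_conj:
  fixes M :: "complex ^ 'q::finite ^ 'q"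
  assumes M: "M ** matrix_adjoint M = mat 1" and A: "bounded_clinear A" and K: "kernel_of A = Gamma_word b f"
  shows "kernel_of (word_op M \<circ> A \<circ> inv (word_op M)) = Gamma_word (M *v b) f"
proof (intro ext)
  fix u v :: "'q list"
  have M': "matrix_adjoint M ** M = mat 1"
    using M matrix_left_right_inverse by blast
  have N: "matrix_adjoint (matrix_adjoint M) ** matrix_adjoint M = mat 1" using M by simp
  have Ac: "coord (A (delta y)) x = Gamma_word b f x y" for x y
    unfolding K[symmetric] kernel_of_def by (rule cinner_delta[symmetric])
  have "inv (word_op M) (delta v) = (\<Sum>y | length y = length v. cnj (tensor_entry M v y) *\<^sub>C delta y)"
    by (rule l2sum_eqI)
      (auto simp: unitary_word_op(2)[OF M] coord_word_op[OF N] coord_sum coord_delta scaleC_complex_def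
        tensor_entry_adjoint if_distrib tensor_entry_length cong: if_cong)
  then have "coord (A (inv (word_op M) (delta v))) x = (\<Sum>y | length y = length v. Gamma_word b f x y * cnj (tensor_entry M v y))" for x
    by (simp add: bounded_clinear_sum[OF A] bounded_clinear_scaleC[OF A] coord_sum Ac scaleC_complex_def mult_ac)
  then have "kernel_of (word_op M \<circ> A \<circ> inv (word_op M)) u v
      = (\<Sum>x | length x = length u. \<Sum>y | length y = length v.
          tensor_entry M u x * Gamma_word b f x y * cnj (tensor_entry M v y))"
    by (simp add: kernel_of_def cinner_delta coord_word_op[OF M'] sum_distrib_left mult.assoc)
  then show "kernel_of (word_op M \<circ> A \<circ> inv (word_op M)) u v = Gamma_word (M *v b) f u v"
    by (simp only: Gamma_word_matrix_vector[OF M])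
qed

lemma Gamma_word_change_of_vector:
  fixes M :: "complex ^ 'q::finite ^ 'q"
  assumes M: "M ** matrix_adjoint M = mat 1" and A: "bounded_clinear A" and K: "kernel_of A = Gamma_word b f"
  shows "bounded_clinear (word_op M \<circ> A \<circ> inv (word_op M))"
    "operator_of (Gamma_word (M *v b) f) = word_op M \<circ> A \<circ> inv (word_op M)"
proof -
  have U: "unitary (word_op M)" by (rule unitary_word_op[OF M])
  show bd: "bounded_clinear (word_op M \<circ> A \<circ> inv (word_op M))"
    by (intro bounded_clinear_compose A unitary_bounded_clinear U unitary_inv)
  show "operator_of (Gamma_word (M *v b) f) = word_op M \<circ> A \<circ> inv (word_op M)"
    by (rule operator_of_eq[OF bd kernel_of_word_op_conj[OF assms]])
qed

section \<open>Regrouping coordinates into a direct sum\<close>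

definition regroup :: "('i \<times> 'j \<Rightarrow> 'x) \<Rightarrow> 'x ell2 \<Rightarrow> ('i, 'j ell2) l2sum"
  where "regroup \<beta> \<phi> = Abs_l2sum (\<lambda>i. Abs_l2sum (\<lambda>j. coord \<phi> (\<beta> (i, j))))"

lemma coord_regroup:
  fixes \<beta> :: "'i \<times> 'j \<Rightarrow> 'x"
  assumes \<beta>: "inj \<beta>"
  shows "coord (coord (regroup \<beta> \<phi>) i) j = coord \<phi> (\<beta> (i, j))"
    and norm_regroup_le: "norm (regroup \<beta> \<phi>) \<le> norm \<phi>"
proof -
  have fin: "(\<Sum>p\<in>P. (cmod (coord \<phi> (\<beta> p)))\<^sup>2) \<le> (norm \<phi>)\<^sup>2" if "finite P" for P
  proof -
    have "inj_on \<beta> P" using \<beta> by (rule inj_on_subset) simp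
    then have "(\<Sum>p\<in>P. (cmod (coord \<phi> (\<beta> p)))\<^sup>2) = (\<Sum>x\<in>\<beta> ` P. (cmod (coord \<phi> x))\<^sup>2)"
      by (simp only: sum.reindex o_def)
    then show ?thesis
      using sum_norm_sq_le_norm_sq[of "\<beta> ` P" \<phi>] that by simp
  qed
  have fin2: "(\<Sum>i\<in>F. \<Sum>j\<in>G. (cmod (coord \<phi> (\<beta> (i, j))))\<^sup>2) \<le> (norm \<phi>)\<^sup>2"
    if "finite F" "finite G" for F G
    using fin[of "F \<times> G"] that by (subst sum.cartesian_product) (simp add: case_prod_beta)
  define x where "x i = (Abs_l2sum (\<lambda>j. coord \<phi> (\<beta> (i, j))) :: 'j ell2)" for i
  have x: "coord (x i) = (\<lambda>j. coord \<phi> (\<beta> (i, j)))" for i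
    unfolding x_def
  proof (rule Abs_l2sum_coord)
    fix F :: "'j set" assume "finite F"
    then show "(\<Sum>j\<in>F. (cmod (coord \<phi> (\<beta> (i, j))))\<^sup>2) \<le> (norm \<phi>)\<^sup>2"
      using fin2[of "{i}" F] by simp
  qed
  have out: "(\<Sum>i\<in>F. (norm (x i))\<^sup>2) \<le> (norm \<phi>)\<^sup>2" if F: "finite F" for F
  proof (rule tendsto_upperbound)
    have "((\<lambda>j. (cmod (coord (x i) j))\<^sup>2) has_sum (norm (x i))\<^sup>2) UNIV" for i
      unfolding norm_sq_l2sum by (rule has_sum_infsum[OF l2_summable])
    then show "((\<lambda>G. \<Sum>i\<in>F. \<Sum>j\<in>G. (cmod (coord (x i) j))\<^sup>2) \<longlongrightarrow> (\<Sum>i\<in>F. (norm (x i))\<^sup>2))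
        (finite_subsets_at_top UNIV)"
      unfolding has_sum_def by (intro tendsto_intros)
    show "\<forall>\<^sub>F G in finite_subsets_at_top UNIV. (\<Sum>i\<in>F. \<Sum>j\<in>G. (cmod (coord (x i) j))\<^sup>2) \<le> (norm \<phi>)\<^sup>2"
      by (rule eventually_finite_subsets_at_top_weakI)
        (simp add: x fin2 F)
  qed simp
  have R: "coord (regroup \<beta> \<phi>) = x"
    unfolding regroup_def x_def[symmetric] by (rule Abs_l2sum_coord[OF out])
  show "coord (coord (regroup \<beta> \<phi>) i) j = coord \<phi> (\<beta> (i, j))" by (simp add: R x)
  have "(norm (regroup \<beta> \<phi>))\<^sup>2 \<le> (norm \<phi>)\<^sup>2"
    by (rule norm_l2sum_sq_le) (simp add: R out)
  then show "norm (regroup \<beta> \<phi>) \<le> norm \<phi>" by (rule power2_le_imp_le) simp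
qed

lemma sum_double_coord_le:
  fixes y :: "('i, 'j ell2) l2sum"
  assumes P: "finite P"
  shows "(\<Sum>p\<in>P. (cmod (coord (coord y (fst p)) (snd p)))\<^sup>2) \<le> (norm y)\<^sup>2"
proof -
  have "(\<Sum>p\<in>P. (cmod (coord (coord y (fst p)) (snd p)))\<^sup>2)
      \<le> (\<Sum>p\<in>fst ` P \<times> snd ` P. (cmod (coord (coord y (fst p)) (snd p)))\<^sup>2)"
    by (rule sum_mono2) (use P in \<open>auto simp: rev_image_eqI\<close>)
  also have "\<dots> = (\<Sum>i\<in>fst ` P. \<Sum>j\<in>snd ` P. (cmod (coord (coord y i) j))\<^sup>2)"
    by (subst sum.cartesian_product) (simp add: case_prod_beta)
  also have "\<dots> \<le> (\<Sum>i\<in>fst ` P. (norm (coord y i))\<^sup>2)"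
    by (intro sum_mono sum_norm_sq_le_norm_sq) (use P in simp)
  also have "\<dots> \<le> (norm y)\<^sup>2"
    by (rule sum_norm_sq_le_norm_sq) (use P in simp)
  finally show ?thesis .
qed

text \<open>Isometry and surjectivity both come from the two inequalities between finite partial sums of
  the single and of the iterated sum of squares.\<close>

lemma unitary_regroup:
  fixes \<beta> :: "'i \<times> 'j \<Rightarrow> 'x"
  assumes \<beta>: "bij \<beta>"
  shows "unitary (regroup \<beta>)"
proof (rule unitaryI)
  have inj: "inj \<beta>" using \<beta> by (simp add: bij_def)
  have i\<beta>: "inv \<beta> (\<beta> p) = p" for p using inj by simp
  have ungroup: "(\<Sum>x\<in>F. (cmod (coord (coord y (fst (inv \<beta> x))) (snd (inv \<beta> x))))\<^sup>2) \<le> (norm y)\<^sup>2"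
    if "finite F" for F and y :: "('i, 'j ell2) l2sum"
    using sum_double_coord_le[of "inv \<beta> ` F" y] that \<beta>
    by (simp add: sum.reindex inj_on_inv_into bij_is_surj)
  note [simp] = coord_regroup[OF inj]
  show "regroup \<beta> (x + y) = regroup \<beta> x + regroup \<beta> y" for x y
    by (intro l2sum_eqI) simp
  show "regroup \<beta> (c *\<^sub>C x) = c *\<^sub>C regroup \<beta> x" for c x
    by (intro l2sum_eqI) simp
  show "norm (regroup \<beta> \<phi>) = norm \<phi>" for \<phi>
  proof (rule antisym[OF norm_regroup_le[OF inj]])
    have "(norm \<phi>)\<^sup>2 \<le> (norm (regroup \<beta> \<phi>))\<^sup>2"
    proof (rule norm_l2sum_sq_le)
      fix F :: "'x set" assume "finite F"
      then show "(\<Sum>x\<in>F. (cmod (coord \<phi> x))\<^sup>2) \<le> (norm (regroup \<beta> \<phi>))\<^sup>2"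
        using ungroup[of F "regroup \<beta> \<phi>"] by (simp add: bij_inv_eq_iff[OF \<beta>] surj_f_inv_f[OF bij_is_surj[OF \<beta>]])
    qed
    then show "norm \<phi> \<le> norm (regroup \<beta> \<phi>)" by (rule power2_le_imp_le) simp
  qed
  show "surj (regroup \<beta>)"
  proof (rule surjI)
    fix y :: "('i, 'j ell2) l2sum"
    show "regroup \<beta> (Abs_l2sum (\<lambda>x. coord (coord y (fst (inv \<beta> x))) (snd (inv \<beta> x)))) = y"
      by (intro l2sum_eqI) (simp add: Abs_l2sum_coord[OF ungroup] i\<beta>)
  qed
qed

lemma
  fixes T :: "'h::cinner_space \<Rightarrow> 'h"
  assumes T: "bounded_clinear T"
  shows coord_direct_sum_op: "coord (direct_sum_op (\<lambda>i. T) y) i = T (coord y i)"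
    and bounded_clinear_direct_sum_op: "bounded_clinear (direct_sum_op (\<lambda>i::'i. T))"
proof -
  obtain B where B: "norm (T x) \<le> norm x * B" for x
    using T bounded_linear.bounded unfolding bounded_clinear_def by blast
  have bd: "(\<Sum>i\<in>F. (norm (T (coord y i)))\<^sup>2) \<le> (norm y * \<bar>B\<bar>)\<^sup>2" if F: "finite F" for F and y :: "('j, 'h) l2sum"
  proof -
    have "(\<Sum>i\<in>F. (norm (T (coord y i)))\<^sup>2) \<le> (\<Sum>i\<in>F. (norm (coord y i))\<^sup>2 * B\<^sup>2)"
      by (intro sum_mono) (metis B norm_ge_zero power_mono power_mult_distrib)
    also have "\<dots> = (\<Sum>i\<in>F. (norm (coord y i))\<^sup>2) * B\<^sup>2" by (simp add: sum_distrib_right)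
    also have "\<dots> \<le> (norm y)\<^sup>2 * B\<^sup>2"
      by (intro mult_right_mono sum_norm_sq_le_norm_sq F) simp
    finally show ?thesis by (simp add: power_mult_distrib)
  qed
  have c: "coord (direct_sum_op (\<lambda>i. T) y) = (\<lambda>i. T (coord y i))" for y :: "('j, 'h) l2sum"
    unfolding direct_sum_op_def by (rule Abs_l2sum_coord[OF bd])
  show "coord (direct_sum_op (\<lambda>i. T) y) i = T (coord y i)" by (simp add: c)
  show "bounded_clinear (direct_sum_op (\<lambda>i::'i. T))"
  proof (rule bounded_clinearI)
    fix y :: "('i, 'h) l2sum"
    show "norm (direct_sum_op (\<lambda>i. T) y) \<le> norm y * \<bar>B\<bar>"
      by (rule power2_le_imp_le[OF norm_l2sum_sq_le]) (simp_all add: c bd)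
  qed (rule l2sum_eqI, simp add: c bounded_clinear_add[OF T] bounded_clinear_scaleC[OF T])+
qed

text \<open>Seen through \<open>\<beta>\<close>, the direct sum is the block diagonal matrix with blocks \<open>T\<close>.\<close>

lemma kernel_of_regroup_direct_sum:
  assumes \<beta>: "bij \<beta>" and T: "bounded_clinear T"
  shows "kernel_of (inv (regroup \<beta>) \<circ> direct_sum_op (\<lambda>i. T) \<circ> regroup \<beta>) (\<beta> (i', j')) (\<beta> (i, j))
    = (if i = i' then kernel_of T j' j else 0)"
proof -
  have inj: "inj \<beta>" using \<beta> by (simp add: bij_def)
  note R = coord_regroup[OF inj]
  have inv: "coord (inv (regroup \<beta>) y) (\<beta> (i', j')) = coord (coord y i') j'" for y
    using R[of "inv (regroup \<beta>) y"] by (simp add: unitary_inv_f[OF unitary_regroup[OF \<beta>]])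
  have d: "coord (regroup \<beta> (delta (\<beta> (i, j)))) i' = (if i = i' then delta j else 0)"
    by (rule l2sum_eqI) (auto simp: R coord_delta inj_eq[OF inj])
  have "T 0 = 0" using bounded_clinear_scaleC[OF T, of 0 0] bounded_clinear_add[OF T, of 0 0] by simp
  then show ?thesis
    by (simp add: kernel_of_def cinner_delta inv coord_direct_sum_op[OF T] d)
qed

section \<open>The kernel of a basis vector\<close>

lemma replicate_append_unique:
  assumes "replicate m k @ u = replicate n k @ v" "u = [] \<or> hd u \<noteq> k" "v = [] \<or> hd v \<noteq> k"
  shows "m = n \<and> u = v"
  using assms
proof (induction m arbitrary: n)
  case 0
  then show ?case by (cases n) auto
next
  case (Suc m)
  then show ?case by (cases n) auto
qed

text \<open>The words that do not begin with \<open>k\<close> index a basis of the orthogonal complement of the range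
  of the shift by \<open>k\<close>.  With a second letter there are infinitely many of them, which makes the
  multiplicity of the shift infinite.\<close>

lemma exists_wandering_enumeration:
  fixes k :: "'q::finite"
  assumes "CARD('q) \<ge> 2"
  shows "\<exists>w. bij_betw w (UNIV :: nat set) {v. v = [] \<or> hd v \<noteq> k}"
proof -
  have "UNIV \<noteq> {k}"
  proof
    assume "UNIV = {k}"
    then have "CARD('q) = card {k}" by (rule arg_cong)
    then show False using assms by simp
  qed
  then obtain j where j: "j \<noteq> k" by blast
  have "range (\<lambda>n. replicate n j) \<subseteq> {v. v = [] \<or> hd v \<noteq> k}"
    using j by auto
  moreover have "inj (\<lambda>n. replicate n j)"
    by (rule injI) (metis length_replicate)
  ultimately have "infinite {v. v = [] \<or> hd v \<noteq> k}"
    using finite_subset range_inj_infinite by blast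
  then obtain e :: "'q list \<Rightarrow> nat" where "bij_betw e {v. v = [] \<or> hd v \<noteq> k} UNIV"
    using countableE_infinite[of "{v. v = [] \<or> hd v \<noteq> k}"] by blast
  then show ?thesis using bij_betw_inv_into by blast
qed

lemma bij_replicate_append:
  assumes w: "bij_betw w (UNIV :: nat set) {v. v = [] \<or> hd v \<noteq> k}"
  shows "bij (\<lambda>(i, n). replicate n k @ w i)"
proof (rule bijI)
  have wi: "w i = [] \<or> hd (w i) \<noteq> k" for i
    using w by (auto simp: bij_betw_def)
  show "inj (\<lambda>(i, n). replicate n k @ w i)"
  proof (rule injI, clarify)
    fix i n j m
    assume "replicate n k @ w i = replicate m k @ w j"
    then have "n = m \<and> w i = w j" by (rule replicate_append_unique[OF _ wi wi])
    then show "i = j \<and> n = m" using w by (simp add: bij_betw_def inj_eq)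
  qed
  show "surj (\<lambda>(i, n). replicate n k @ w i)"
  proof (rule surjI[of _ "\<lambda>v. (inv_into UNIV w (dropWhile (\<lambda>x. x = k) v), length (takeWhile (\<lambda>x. x = k) v))"])
    fix v
    have "dropWhile (\<lambda>x. x = k) v \<in> range w"
      using w hd_dropWhile[of "\<lambda>x. x = k" v] by (auto simp: bij_betw_def)
    moreover have "replicate (length (takeWhile (\<lambda>x. x = k) v)) k = takeWhile (\<lambda>x. x = k) v"
      by (rule replicate_eqI[symmetric]) (auto dest: set_takeWhileD)
    ultimately show "(case (inv_into UNIV w (dropWhile (\<lambda>x. x = k) v), length (takeWhile (\<lambda>x. x = k) v)) of
        (i, n) \<Rightarrow> replicate n k @ w i) = v"
      by (simp add: f_inv_into_f)
  qed
qed

lemma word_eval_axis: "word_eval w (axis k 1) = (if w = replicate (length w) k then 1 else 0)"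
  by (induction w) (auto simp: axis_def)

text \<open>The factor \<open>word_eval p (axis k 1)\<close> vanishes unless the connecting prefix \<open>p\<close> is a power of \<open>k\<close>;
  so the kernel only relates words with the same remainder after their leading letters \<open>k\<close>.\<close>

lemma Gamma_word_axis:
  assumes u: "u = [] \<or> hd u \<noteq> k" and v: "v = [] \<or> hd v \<noteq> k"
  shows "Gamma_word (axis k 1) f (replicate m k @ u) (replicate n k @ v)
    = (if u = v then f (int m - int n) else 0)"
proof -
  have pre: "Gamma_word (axis k 1) f (replicate m k @ u) (replicate n k @ v)
      = (if u = v then f (int m - int n) else 0)"
    if p: "replicate m k @ u = p @ replicate n k @ v" and u: "u = [] \<or> hd u \<noteq> k" and v: "v = [] \<or> hd v \<noteq> k"
    for p m n u v f
  proof (cases "p = replicate (length p) k")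
    case True
    then have "replicate m k @ u = replicate (length p + n) k @ v"
      using p by (metis append.assoc replicate_add)
    then have "m = length p + n \<and> u = v"
      by (rule replicate_append_unique[OF _ u v])
    moreover have "word_eval p (axis k 1) = 1" using True by (simp add: word_eval_axis)
    ultimately show ?thesis unfolding p Gamma_word_append by simp
  next
    case False
    have "u \<noteq> v"
    proof
      assume "u = v"
      then have "replicate m k = p @ replicate n k" using p by simp
      then have "\<forall>x\<in>set p. x = k" by (metis UnCI in_set_replicate set_append)
      then show False using False replicate_eqI[of p "length p" k] by blast
    qed
    then show ?thesis using False by (simp add: p Gamma_word_append word_eval_axis)
  qed
  consider p where "replicate m k @ u = p @ replicate n k @ v" | p where "replicate n k @ v = p @ replicate m k @ u"
    | "\<nexists>p. replicate m k @ u = p @ replicate n k @ v" "\<nexists>p. replicate n k @ v = p @ replicate m k @ u"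
    by blast
  then show ?thesis
  proof cases
    case 1
    then show ?thesis by (rule pre[OF _ u v])
  next
    case 2
    show ?thesis
      by (subst Gamma_word_cnj, subst pre[OF 2 v u]) auto
  next
    case 3
    have "u \<noteq> v"
    proof
      assume "u = v"
      show False
      proof (cases "n \<le> m")
        case True
        then have "replicate m k @ u = replicate (m - n) k @ replicate n k @ v"
          by (simp add: \<open>u = v\<close> flip: append.assoc replicate_add)
        then show False using 3 by blast
      next
        case False
        then have "replicate n k @ v = replicate (n - m) k @ replicate m k @ u"
          by (simp add: \<open>u = v\<close> flip: append.assoc replicate_add)
        then show False using 3 by blast
      qed
    qed
    with 3 show ?thesis by (simp add: Gamma_word_def)
  qed
qed

section \<open>The tree kernel\<close>

lemma tree_edges_relpow_length:
  "(x, y) \<in> tree_edges ^^ n \<Longrightarrow> \<bar>int (length x) - int (length y)\<bar> \<le> int n"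
proof (induction n arbitrary: y)
  case (Suc n)
  then obtain z where z: "(x, z) \<in> tree_edges ^^ n" "(z, y) \<in> tree_edges" by auto
  then have "\<bar>int (length z) - int (length y)\<bar> = 1" by (auto simp: tree_edges_def)
  with Suc.IH[OF z(1)] show ?case by simp
qed simp

lemma tree_path_up: "(v, w @ v) \<in> tree_edges ^^ length w"
  by (induction w) (auto intro!: relpow_Suc_I simp: tree_edges_def simp del: relpow.simps(2))

lemma tree_path_down: "(w @ v, v) \<in> tree_edges ^^ length w"
proof (induction w)
  case (Cons s w)
  have "((s # w) @ v, w @ v) \<in> tree_edges" by (simp add: tree_edges_def)
  then show ?case using Cons.IH by (auto intro: relpow_Suc_I2 simp del: relpow.simps(2))
qed simp

lemma tree_dist_append:
  "tree_dist v (w @ v) = length w" "tree_dist (w @ v) v = length w"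
proof -
  show "tree_dist v (w @ v) = length w"
    unfolding tree_dist_def
  proof (rule Least_equality)
    fix n assume "(v, w @ v) \<in> tree_edges ^^ n"
    then show "length w \<le> n" using tree_edges_relpow_length by fastforce
  qed (rule tree_path_up)
  show "tree_dist (w @ v) v = length w"
    unfolding tree_dist_def
  proof (rule Least_equality)
    fix n assume "(w @ v, v) \<in> tree_edges ^^ n"
    then show "length w \<le> n" using tree_edges_relpow_length by fastforce
  qed (rule tree_path_down)
qed

lemma tree_height_eq_length: "tree_height x = length x"
  using tree_dist_append(1)[of "[]" x] by (simp add: tree_height_def tree_root_def)

lemma tree_dist_path: "(x, y) \<in> tree_edges ^^ tree_dist x y"
proof -
  have "(x, y) \<in> tree_edges ^^ (length x + length y)"
    using tree_path_down[of x "[]"] tree_path_up[of "[]" y] by (auto simp: relpow_add)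
  then show ?thesis unfolding tree_dist_def by (rule LeastI)
qed

text \<open>Along a ray from the root the height grows by one at each step, so each step goes to a
  child.\<close>

lemma geodesic_ray_iff: "geodesic_ray \<gamma> \<longleftrightarrow> \<gamma> 0 = [] \<and> (\<forall>n. \<exists>s. \<gamma> (Suc n) = s # \<gamma> n)"
proof safe
  assume \<gamma>: "geodesic_ray \<gamma>"
  then have d: "int (tree_dist (\<gamma> i) (\<gamma> j)) = \<bar>int i - int j\<bar>" for i j
    by (simp add: geodesic_ray_def)
  show 0: "\<gamma> 0 = []" using \<gamma> by (simp add: geodesic_ray_def tree_root_def)
  have l: "length (\<gamma> n) = n" for n
    using d[of 0 n] tree_dist_append(1)[of "[]" "\<gamma> n"] by (simp add: 0)
  fix n
  have "tree_dist (\<gamma> n) (\<gamma> (Suc n)) = 1" using d[of n "Suc n"] by simp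
  then have "(\<gamma> n, \<gamma> (Suc n)) \<in> tree_edges"
    using tree_dist_path[of "\<gamma> n" "\<gamma> (Suc n)"] by simp
  then show "\<exists>s. \<gamma> (Suc n) = s # \<gamma> n"
    using l[of n] l[of "Suc n"] by (auto simp: tree_edges_def)
next
  assume 0: "\<gamma> 0 = []" and step: "\<forall>n. \<exists>s. \<gamma> (Suc n) = s # \<gamma> n"
  have ext: "\<exists>w. \<gamma> (n + i) = w @ \<gamma> i \<and> length w = n" for i n
  proof (induction n)
    case (Suc n)
    then obtain w where w: "\<gamma> (n + i) = w @ \<gamma> i" "length w = n" by blast
    obtain s where "\<gamma> (Suc (n + i)) = s # \<gamma> (n + i)" using step by blast
    then show ?case using w by (intro exI[of _ "s # w"]) simp
  qed simp
  have "int (tree_dist (\<gamma> i) (\<gamma> j)) = \<bar>int i - int j\<bar>" for i j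
  proof (cases "i \<le> j")
    case True
    then show ?thesis using ext[of "j - i" i] by (auto simp: tree_dist_append)
  next
    case False
    then show ?thesis using ext[of "i - j" j] by (auto simp: tree_dist_append)
  qed
  then show "geodesic_ray \<gamma>" by (simp add: geodesic_ray_def tree_root_def 0)
qed

text \<open>A vertex is the list of labels up to the root, so the ancestors of a vertex are its
  suffixes.\<close>

lemma comparable_iff_suffix: "comparable x y \<longleftrightarrow> (\<exists>w. x = w @ y) \<or> (\<exists>w. y = w @ x)"
proof
  assume "comparable x y"
  then obtain \<gamma> i j where \<gamma>: "geodesic_ray \<gamma>" and x: "x = \<gamma> i" and y: "y = \<gamma> j"
    unfolding comparable_def by auto
  have ext: "\<exists>w. \<gamma> n = w @ \<gamma> m" if "m \<le> n" for m n
    using that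
  proof (induction n rule: dec_induct)
    case (step n)
    then obtain w where w: "\<gamma> n = w @ \<gamma> m" by blast
    obtain s where "\<gamma> (Suc n) = s # \<gamma> n" using \<gamma> unfolding geodesic_ray_iff by blast
    then show ?case using w by (intro exI[of _ "s # w"]) simp
  qed simp
  show "(\<exists>w. x = w @ y) \<or> (\<exists>w. y = w @ x)"
    using ext[of i j] ext[of j i] x y by (metis nat_le_linear)
next
  have *: "\<exists>\<gamma>. geodesic_ray \<gamma> \<and> w @ y \<in> range \<gamma> \<and> y \<in> range \<gamma>" for w y :: "'a list"
  proof -
    let ?x = "w @ y"
    \<comment> \<open>the ray from the root through \<open>w @ y\<close>, prolonged by an arbitrary label\<close>
    define \<gamma> where "\<gamma> n = replicate (n - length ?x) undefined @ drop (length ?x - n) ?x" for n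
    have "\<exists>s. \<gamma> (Suc n) = s # \<gamma> n" for n
    proof (cases "n < length ?x")
      case True
      then have "drop (length ?x - Suc n) ?x = ?x ! (length ?x - Suc n) # drop (Suc (length ?x - Suc n)) ?x"
        by (intro Cons_nth_drop_Suc[symmetric]) simp
      also have "Suc (length ?x - Suc n) = length ?x - n" using True by simp
      finally show ?thesis using True by (simp add: \<gamma>_def del: drop_append length_append)
    next
      case False
      then have "Suc n - length ?x = Suc (n - length ?x)" by simp
      then show ?thesis using False by (simp add: \<gamma>_def del: drop_append length_append)
    qed
    moreover have "\<gamma> 0 = []" by (simp add: \<gamma>_def)
    moreover have "\<gamma> (length ?x) = ?x" "\<gamma> (length y) = y" by (simp_all add: \<gamma>_def)
    ultimately show ?thesis unfolding geodesic_ray_iff by (metis rangeI)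
  qed
  assume "(\<exists>w. x = w @ y) \<or> (\<exists>w. y = w @ x)"
  then show "comparable x y" unfolding comparable_def using * by blast
qed

lemma word_eval_const: "word_eval w (\<chi> i. c) = c ^ length w"
  by (induction w) simp_all

lemma Gamma_tree_eq_Gamma_word:
  "Gamma_tree f = Gamma_word (\<chi> i :: 'q::finite. complex_of_real (1 / sqrt (real CARD('q)))) f"
proof (intro ext)
  fix u v :: "'q list"
  let ?c = "complex_of_real (1 / sqrt (real CARD('q)))"
  let ?b = "\<chi> i :: 'q. ?c"
  have pw: "complex_of_real (real CARD('q) powr (- real n / 2)) = ?c ^ n" for n
  proof -
    have "real CARD('q) powr (- real n / 2) = (real CARD('q) powr (- (1 / 2))) ^ n"
      by (simp add: powr_power)
    also have "real CARD('q) powr (- (1 / 2)) = 1 / sqrt (real CARD('q))"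
      using powr_half_sqrt[of "real CARD('q)"]
      by (simp only: powr_minus of_nat_0_le_iff inverse_eq_divide)
    finally show ?thesis by (simp only: of_real_power)
  qed
  have longer: "Gamma_tree f (w @ v) v = Gamma_word ?b f (w @ v) v" for w v f
    unfolding Gamma_tree_def Gamma_word_append
    using pw[of "length w"]
    by (simp add: comparable_iff_suffix tree_dist_append tree_height_eq_length word_eval_const)
  have flip: "Gamma_tree f u v = cnj (Gamma_tree (\<lambda>n. cnj (f (- n))) v u)" for u v f
  proof -
    have "tree_dist u v = tree_dist v u" if "comparable u v"
      using that by (auto simp: comparable_iff_suffix tree_dist_append)
    moreover have "comparable u v \<longleftrightarrow> comparable v u" by (auto simp: comparable_iff_suffix)
    ultimately show ?thesis by (simp add: Gamma_tree_def)
  qed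
  consider w where "u = w @ v" | w where "v = w @ u" | "\<nexists>w. u = w @ v" "\<nexists>w. v = w @ u"
    by blast
  then show "Gamma_tree f u v = Gamma_word ?b f u v"
  proof cases
    case 1
    then show ?thesis by (simp only: longer)
  next
    case 2
    show ?thesis
      unfolding flip[of f u v] Gamma_word_cnj[of _ f u v] by (simp only: 2 longer)
  next
    case 3
    then show ?thesis by (simp add: Gamma_tree_def Gamma_word_def comparable_iff_suffix)
  qed
qed



section \<open>The unitary model of the word kernels\<close>

lemma operator_of_bounded:
  assumes "defines_bounded_operator K"
  shows "bounded_clinear (operator_of K)" "kernel_of (operator_of K) = K"
proof -
  obtain A where A: "bounded_clinear A" "kernel_of A = K"
    using assms unfolding defines_bounded_operator_def by blast
  then have "operator_of K = A" by (rule operator_of_eq)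
  with A show "bounded_clinear (operator_of K)" "kernel_of (operator_of K) = K" by simp_all
qed

text \<open>The letter \<open>k\<close> is arbitrary.  The unitary first undoes the tensor powers of a matrix that
  maps \<open>e\<^sub>k\<close> to \<open>a\<close>, and then sorts the words by what follows their leading letters \<open>k\<close>; neither
  step involves \<open>f\<close>.\<close>

lemma Gamma_word_model:
  fixes a :: "complex ^ 'q"
  assumes q: "CARD('q) \<ge> 2" and a: "a \<in> unit_sphere"
  shows "\<exists>U :: 'q list ell2 \<Rightarrow> (nat, nat ell2) l2sum. unitary U \<and>
    (\<forall>f\<in>Linf_series. defines_bounded_operator (Gamma_word a f) \<and>
      operator_of (Gamma_word a f) = inv U \<circ> direct_sum_op (\<lambda>k. operator_of (Gamma_nat f)) \<circ> U)"
proof -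
  fix k :: 'q
  obtain M where M: "M ** matrix_adjoint M = mat 1" and Mk: "M *v axis k 1 = a"
    using exists_unitary_matrix_to[OF a] by blast
  obtain w where w: "bij_betw w (UNIV :: nat set) {v. v = [] \<or> hd v \<noteq> k}"
    using exists_wandering_enumeration[OF q] by blast
  define \<beta> where "\<beta> = (\<lambda>(i, n). replicate n k @ w i)"
  have \<beta>: "bij \<beta>" unfolding \<beta>_def by (rule bij_replicate_append[OF w])
  have R: "unitary (regroup \<beta>)" by (rule unitary_regroup[OF \<beta>])
  have V: "unitary (word_op M)" by (rule unitary_word_op[OF M])
  define U where "U = regroup \<beta> \<circ> inv (word_op M)"
  have "defines_bounded_operator (Gamma_word a f) \<and>
      operator_of (Gamma_word a f) = inv U \<circ> direct_sum_op (\<lambda>k. operator_of (Gamma_nat f)) \<circ> U"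
    if f: "f \<in> Linf_series" for f
  proof -
    define T where "T = operator_of (Gamma_nat f)"
    have "defines_bounded_operator (Gamma_nat f)"
      using Linf_series_imp_form_bounded[OF f] form_bounded_imp_bounded_operator by blast
    then have T: "bounded_clinear T" and KT: "kernel_of T = Gamma_nat f"
      unfolding T_def by (rule operator_of_bounded)+
    define A where "A = inv (regroup \<beta>) \<circ> direct_sum_op (\<lambda>_. T) \<circ> regroup \<beta>"
    have A: "bounded_clinear A"
      unfolding A_def by (intro bounded_clinear_compose bounded_clinear_direct_sum_op T
          unitary_bounded_clinear unitary_inv R)
    have KA: "kernel_of A = Gamma_word (axis k 1) f"
    proof (intro ext)
      fix u v
      obtain i m j n where uv: "u = \<beta> (i, m)" "v = \<beta> (j, n)"
        using bij_is_surj[OF \<beta>] by (metis surjD surj_pair)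
      have "w i = [] \<or> hd (w i) \<noteq> k" "w j = [] \<or> hd (w j) \<noteq> k" "w i = w j \<longleftrightarrow> i = j"
        using w by (auto simp: bij_betw_def inj_eq)
      then show "kernel_of A u v = Gamma_word (axis k 1) f u v"
        unfolding A_def uv kernel_of_regroup_direct_sum[OF \<beta> T] KT
        by (simp add: \<beta>_def Gamma_word_axis Gamma_nat_def)
    qed
    have "inv U = word_op M \<circ> inv (regroup \<beta>)"
      unfolding U_def by (simp add: o_inv_distrib unitary_bij V R unitary_inv inv_inv_eq)
    then have eq: "inv U \<circ> direct_sum_op (\<lambda>_. T) \<circ> U = word_op M \<circ> A \<circ> inv (word_op M)"
      by (simp add: A_def U_def comp_assoc)
    have "defines_bounded_operator (Gamma_word a f)"
      unfolding defines_bounded_operator_def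
      using Gamma_word_change_of_vector(1)[OF M A KA] kernel_of_word_op_conj[OF M A KA] Mk by blast
    then show ?thesis
      using Gamma_word_change_of_vector(2)[OF M A KA] by (simp add: Mk eq flip: T_def)
  qed
  moreover have "unitary U"
    unfolding U_def by (intro unitary_compose unitary_inv R V)
  ultimately show ?thesis by blast
qed

text \<open>Going back from \<open>a\<close> to \<open>e\<^sub>k\<close> with the adjoint matrix, the entries at the powers of \<open>k\<close> form the
  Toeplitz matrix of \<open>f\<close>.\<close>

lemma bounded_Gamma_word_imp_Linf:
  fixes a :: "complex ^ 'q"
  assumes a: "a \<in> unit_sphere" and bd: "defines_bounded_operator (Gamma_word a f)"
  shows "f \<in> Linf_series"
proof -
  fix k :: 'q
  obtain M where M: "M ** matrix_adjoint M = mat 1" and Mk: "M *v axis k 1 = a"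
    using exists_unitary_matrix_to[OF a] by blast
  let ?N = "matrix_adjoint M"
  have N1: "?N ** M = mat 1" using M matrix_left_right_inverse by blast
  then have N: "?N ** matrix_adjoint ?N = mat 1" by simp
  have "?N *v a = axis k 1"
    unfolding Mk[symmetric] matrix_vector_mul_assoc N1 by simp
  then have "defines_bounded_operator (Gamma_word (axis k 1) f)"
    using Gamma_word_change_of_vector(1)[OF N operator_of_bounded[OF bd]]
      kernel_of_word_op_conj[OF N operator_of_bounded[OF bd]]
    unfolding defines_bounded_operator_def by metis
  then obtain C where C: "form_bounded (Gamma_word (axis k 1) f) C"
    using bounded_operator_imp_form_bounded by blast
  have "inj (\<lambda>n. replicate n k)" by (rule injI) (metis length_replicate)
  from form_bounded_reindex[OF C this] have "form_bounded (Gamma_nat f) C"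
    using Gamma_word_axis[of "[]" k "[]" f] by (simp add: Gamma_nat_def[abs_def])
  then show ?thesis by (rule form_bounded_imp_Linf_series)
qed

theorem theorem1p11:
  fixes a :: "complex ^ 'q"
  assumes "CARD('q) \<ge> 2"
    and "a \<in> unit_sphere"
  shows "(\<forall>f. defines_bounded_operator (Gamma_word a f) \<longleftrightarrow> f \<in> Linf_series) \<and>
    (\<exists>U :: 'q list ell2 \<Rightarrow> (nat, nat ell2) l2sum. unitary U \<and>
      (\<forall>f\<in>Linf_series. operator_of (Gamma_word a f) =
        inv U \<circ> direct_sum_op (\<lambda>k. operator_of (Gamma_nat f)) \<circ> U)) \<and>
    (\<exists>W :: 'q tree_vertex ell2 \<Rightarrow> 'q list ell2. unitary W \<and>
      (\<forall>f\<in>Linf_series. operator_of (Gamma_tree f) =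
        inv W \<circ> operator_of (Gamma_word a f) \<circ> W))"
proof -
  obtain U :: "'q list ell2 \<Rightarrow> (nat, nat ell2) l2sum" where U: "unitary U"
    and model: "\<And>f. f \<in> Linf_series \<Longrightarrow> defines_bounded_operator (Gamma_word a f) \<and>
      operator_of (Gamma_word a f) = inv U \<circ> direct_sum_op (\<lambda>k. operator_of (Gamma_nat f)) \<circ> U"
    using Gamma_word_model[OF assms] by blast
  \<comment> \<open>the tree kernel is the word kernel of \<open>b\<close>, so both kernels have unitary models with the same direct sum\<close>
  define b where "b = (\<chi> i :: 'q. complex_of_real (1 / sqrt (real CARD('q))))"
  have "b \<in> unit_sphere"
    by (simp add: b_def unit_sphere_def norm_divide power_divide)
  then obtain U' :: "'q list ell2 \<Rightarrow> (nat, nat ell2) l2sum" where U': "unitary U'"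
    and model': "\<And>f. f \<in> Linf_series \<Longrightarrow>
      operator_of (Gamma_tree f) = inv U' \<circ> direct_sum_op (\<lambda>k. operator_of (Gamma_nat f)) \<circ> U'"
    using Gamma_word_model[OF assms(1)] unfolding Gamma_tree_eq_Gamma_word b_def by blast
  define W where "W = inv U \<circ> U'"
  have W: "unitary W" unfolding W_def by (intro unitary_compose unitary_inv U U')
  have "inv W = inv U' \<circ> U"
    unfolding W_def by (simp add: o_inv_distrib unitary_bij U U' unitary_inv inv_inv_eq)
  then have "operator_of (Gamma_tree f) = inv W \<circ> operator_of (Gamma_word a f) \<circ> W"
    if "f \<in> Linf_series" for f
    using model[OF that] model'[OF that]
    by (auto simp: fun_eq_iff W_def unitary_inv_f[OF U])
  then show ?thesis
    using model bounded_Gamma_word_imp_Linf[OF assms(2)] U W by blast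
qed

end
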